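(* Let $N$ be a zero-delayed renewal process whose interarrival distribution $F$ has a density $f$ with respect to Lebesgue measure, $F(x)=\int_0^x f(s)\,ds$, and finite mean $\int_0^\infty xF(dx)<\infty$. Let $\Lambda$ be the compensator of $N$. Then, for any $p>0$, the convergence in distribution $$\left(\frac{1}{T^p}\left[\Lambda(Tv)-\Lambda\left(S_{N(Tv)-1}\right)\right]\right)_{v\in[0,1]}\ \longrightarrow\ 0\qquad (T\to\infty)$$ holds in the space $D([0,1])$ of real-valued c\`adl\`ag functions on $[0,1]$ equipped with the Skorokhod topology, where the limit is the identically zero function.
   Context: $\tau_1,\tau_2,\dots$ are i.i.d. random variables with values in $(0,\infty)$ and distribution function $F(x)=\mathbb{P}(\tau_1\le x)$. Put $S_0=0$ and $S_n=\tau_1+\dots+\tau_n$ for $n\ge 1$. The zero-delayed renewal process is $N(t)=\sum_{n\ge 0}1_{\{S_n\le t\}}$, $t\ge 0$ (the renewal at time $0$ is counted, so $N(0)=1$ and $S_{N(t)-1}\le t<S_{N(t)}$). $(\mathcal{F}^N_t)_{t\ge 0}$ denotes the augmentation of the natural filtration $\sigma(N(s);0\le s\le t)$, $t\ge 0$. The compensator $\Lambda$ of $N$ is the increasing, a.s. finite, predictable process with $\Lambda(0)=0$ given by the Doob--Meyer decomposition, i.e. such that $N-\Lambda$ is an $(\mathcal{F}^N_t)$-martingale. *)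

theory Defs
  imports "HOL-Probability.Probability"
begin

section \<open>The Skorokhod space on the unit interval\<close>

definition cadlag01 :: "(real \<Rightarrow> real) \<Rightarrow> bool" where
  "cadlag01 x \<longleftrightarrow>
     (\<forall>t\<in>{0..<1}. (x \<longlongrightarrow> x t) (at_right t)) \<and>
     (\<forall>t\<in>{0<..1}. \<exists>l. (x \<longlongrightarrow> l) (at_left t))"

text \<open>Functions on the unit interval are represented by functions on the line that are
  \<^const>\<open>undefined\<close> outside of it, so that equality in the type is equality on the interval.\<close>

typedef D01 = "{x :: real \<Rightarrow> real. cadlag01 x \<and> x \<in> extensional {0..1}}"
  morphisms path_of Abs_D01
proof -
  let ?z = "restrict (\<lambda>_. 0 :: real) {0..1 :: real}"
  have "(?z \<longlongrightarrow> ?z t) (at_right t)" if "t \<in> {0..<1}" for t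
  proof (rule tendsto_eventually)
    show "\<forall>\<^sub>F s in at_right t. ?z s = ?z t"
      using that by (auto simp: eventually_at_right_field intro!: exI[of _ 1])
  qed
  moreover have "(?z \<longlongrightarrow> 0) (at_left t)" if "t \<in> {0<..1}" for t
  proof (rule tendsto_eventually)
    show "\<forall>\<^sub>F s in at_left t. ?z s = 0"
      using that by (auto simp: eventually_at_left_field intro!: exI[of _ 0])
  qed
  ultimately show ?thesis
    unfolding cadlag01_def by (intro exI[of _ ?z] CollectI conjI ballI restrict_extensional) blast+
qed

text \<open>The element of the Skorokhod space given by a cadlag path. Paths that are not cadlag are sent
  to the zero function; this is only ever used for paths that are almost surely cadlag.\<close>

definition to_D01 :: "(real \<Rightarrow> real) \<Rightarrow> D01" where
  "to_D01 x = Abs_D01 (restrict (if cadlag01 x then x else (\<lambda>_. 0)) {0..1})"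

definition time_change :: "(real \<Rightarrow> real) \<Rightarrow> bool" where
  "time_change l \<longleftrightarrow>
     continuous_on {0..1} l \<and> strict_mono_on {0..1} l \<and> l ` {0..1} = {0..1}"

definition skorokhod_close :: "(real \<Rightarrow> real) \<Rightarrow> (real \<Rightarrow> real) \<Rightarrow> real \<Rightarrow> bool" where
  "skorokhod_close x y e \<longleftrightarrow>
     (\<exists>l. time_change l \<and> (\<forall>t\<in>{0..1}. \<bar>l t - t\<bar> \<le> e \<and> \<bar>x t - y (l t)\<bar> \<le> e))"

lemma cadlag01_bounded:
  assumes "cadlag01 x"
  obtains B where "\<And>t. t \<in> {0..1} \<Longrightarrow> \<bar>x t\<bar> \<le> B"
proof -
  define P where "P a b \<longleftrightarrow> (\<exists>B. \<forall>t\<in>{a..b} \<inter> {0..1}. \<bar>x t\<bar> \<le> B)" for a b :: real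
  have "P 0 1"
  proof (rule Bolzano)
    fix a b c assume "P a b" "P b c"
    then obtain B C where "\<forall>t\<in>{a..b} \<inter> {0..1}. \<bar>x t\<bar> \<le> B" "\<forall>t\<in>{b..c} \<inter> {0..1}. \<bar>x t\<bar> \<le> C"
      by (auto simp: P_def)
    then have "\<forall>t\<in>{a..c} \<inter> {0..1}. \<bar>x t\<bar> \<le> max B C"
      by (fastforce simp: le_max_iff_disj)
    then show "P a c" by (auto simp: P_def)
  next
    fix t :: real assume t: "0 \<le> t" "t \<le> 1"
    have "\<exists>d>0. \<exists>B. \<forall>s\<in>{t<..<t+d} \<inter> {0..1}. \<bar>x s\<bar> \<le> B"
    proof (cases "t < 1")
      case True
      then have "(x \<longlongrightarrow> x t) (at_right t)" using assms t by (auto simp: cadlag01_def)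
      then have "\<forall>\<^sub>F s in at_right t. dist (x s) (x t) < 1" by (rule tendstoD) simp
      then obtain b where "b > t" "\<And>s. s > t \<Longrightarrow> s < b \<Longrightarrow> dist (x s) (x t) < 1"
        by (auto simp: eventually_at_right_field)
      then show ?thesis
        by (intro exI[of _ "b - t"] conjI exI[of _ "\<bar>x t\<bar> + 1"]) (force simp: dist_real_def)+
    qed (use t in \<open>auto intro!: exI[of _ 1]\<close>)
    then obtain d1 B1 where 1: "d1 > 0" "\<forall>s\<in>{t<..<t+d1} \<inter> {0..1}. \<bar>x s\<bar> \<le> B1" by auto
    have "\<exists>d>0. \<exists>B. \<forall>s\<in>{t-d<..<t} \<inter> {0..1}. \<bar>x s\<bar> \<le> B"
    proof (cases "t > 0")
      case True
      then obtain l where "(x \<longlongrightarrow> l) (at_left t)"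
        using assms t unfolding cadlag01_def by (meson greaterThanAtMost_iff)
      then have "\<forall>\<^sub>F s in at_left t. dist (x s) l < 1" by (rule tendstoD) simp
      then obtain b where "b < t" "\<And>s. s > b \<Longrightarrow> s < t \<Longrightarrow> dist (x s) l < 1"
        by (auto simp: eventually_at_left_field)
      then show ?thesis
        by (intro exI[of _ "t - b"] conjI exI[of _ "\<bar>l\<bar> + 1"]) (force simp: dist_real_def)+
    qed (use t in \<open>auto intro!: exI[of _ 1]\<close>)
    then obtain d2 B2 where 2: "d2 > 0" "\<forall>s\<in>{t-d2<..<t} \<inter> {0..1}. \<bar>x s\<bar> \<le> B2" by auto
    show "\<exists>d>0. \<forall>a b. a \<le> t \<and> t \<le> b \<and> b - a < d \<longrightarrow> P a b"
    proof (intro exI[of _ "min d1 d2"] conjI allI impI)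
      fix a b assume ab: "a \<le> t \<and> t \<le> b \<and> b - a < min d1 d2"
      have "\<bar>x s\<bar> \<le> max \<bar>x t\<bar> (max B1 B2)" if s: "s \<in> {a..b} \<inter> {0..1}" for s
      proof -
        consider "s = t" | "s > t" | "s < t" by linarith
        then show ?thesis
        proof cases
          case 2
          then have "\<bar>x s\<bar> \<le> B1" using 1 s ab by auto
          then show ?thesis by auto
        next
          case 3
          then have "\<bar>x s\<bar> \<le> B2" using 2(2) s ab by auto
          then show ?thesis by auto
        qed auto
      qed
      then show "P a b" unfolding P_def by blast
    qed (use 1 2 in auto)
  qed auto
  then show ?thesis using that unfolding P_def by fastforce
qed

lemma time_change_id: "time_change (\<lambda>t. t)"
  by (auto simp: time_change_def strict_mono_on_def)

lemma time_change_mem: "time_change l \<Longrightarrow> t \<in> {0..1} \<Longrightarrow> l t \<in> {0..1}"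
  unfolding time_change_def by blast

lemma time_change_1:
  assumes "time_change l" shows "l 1 = 1"
proof (rule antisym)
  show "l 1 \<le> 1" using time_change_mem[OF assms, of 1] by auto
  have "(1 :: real) \<in> l ` {0..1}" using assms by (auto simp: time_change_def)
  then obtain t where t: "t \<in> {0..1}" "l t = 1" by auto
  then have "l t \<le> l 1"
    using assms by (intro strict_mono_on_leD[of "{0..1}" l]) (auto simp: time_change_def)
  with t show "1 \<le> l 1" by simp
qed

lemma skorokhod_close_sym:
  assumes "skorokhod_close x y e" shows "skorokhod_close y x e"
proof -
  obtain l where l: "time_change l"
    and e: "\<And>t. t \<in> {0..1} \<Longrightarrow> \<bar>l t - t\<bar> \<le> e \<and> \<bar>x t - y (l t)\<bar> \<le> e"
    using assms by (auto simp: skorokhod_close_def)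
  have inj: "inj_on l {0..1}" and im: "l ` {0..1} = {0..1}" and sm: "strict_mono_on {0..1} l"
    and cont: "continuous_on {0..1} l"
    using l by (auto simp: time_change_def strict_mono_on_imp_inj_on)
  define m where "m = the_inv_into {0..1} l"
  have ml: "m (l t) = t" if "t \<in> {0..1}" for t
    using that inj by (simp add: m_def the_inv_into_f_f)
  have lm: "l (m t) = t" "m t \<in> {0..1}" if "t \<in> {0..1}" for t
    using that inj im f_the_inv_into_f[OF inj, of t] the_inv_into_into[OF inj, of t "{0..1}"]
    by (auto simp: m_def)
  have "continuous_on {0..1} m"
    using continuous_on_inv[OF cont compact_Icc, of m] ml im by auto
  moreover have "strict_mono_on {0..1} m"
    unfolding strict_mono_on_def
  proof (intro allI impI)
    fix r s :: real assume rs: "r \<in> {0..1} \<and> s \<in> {0..1} \<and> r < s"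
    show "m r < m s"
    proof (rule ccontr)
      assume "\<not> m r < m s"
      then have "l (m s) \<le> l (m r)"
        using rs lm sm by (intro strict_mono_on_leD[of "{0..1}" l]) auto
      then show False using rs lm by auto
    qed
  qed
  moreover have "m ` {0..1} = {0..1}"
    using lm(2) ml im by (auto simp: image_iff) (metis atLeastAtMost_iff imageI)
  ultimately have "time_change m" by (simp add: time_change_def)
  moreover have "\<bar>m t - t\<bar> \<le> e \<and> \<bar>y t - x (m t)\<bar> \<le> e" if "t \<in> {0..1}" for t
    using e[OF lm(2)[OF that]] lm(1)[OF that] by (simp add: abs_minus_commute)
  ultimately show ?thesis by (auto simp: skorokhod_close_def)
qed

lemma skorokhod_close_trans:
  assumes "skorokhod_close x y e" "skorokhod_close y z e'"
  shows "skorokhod_close x z (e + e')"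
proof -
  obtain l where l: "time_change l"
    and e: "\<And>t. t \<in> {0..1} \<Longrightarrow> \<bar>l t - t\<bar> \<le> e \<and> \<bar>x t - y (l t)\<bar> \<le> e"
    using assms by (auto simp: skorokhod_close_def)
  obtain l' where l': "time_change l'"
    and e': "\<And>t. t \<in> {0..1} \<Longrightarrow> \<bar>l' t - t\<bar> \<le> e' \<and> \<bar>y t - z (l' t)\<bar> \<le> e'"
    using assms by (auto simp: skorokhod_close_def)
  have "continuous_on {0..1} (l' \<circ> l)"
    using l l' by (intro continuous_on_compose) (auto simp: time_change_def)
  moreover have "strict_mono_on {0..1} (l' \<circ> l)"
    using l l' time_change_mem[OF l]
    by (auto simp: time_change_def strict_mono_on_def)
  moreover have "(l' \<circ> l) ` {0..1} = {0..1}"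
    using l l' by (simp only: image_comp[symmetric] time_change_def)
  ultimately have "time_change (l' \<circ> l)" by (simp add: time_change_def)
  moreover have "\<bar>(l' \<circ> l) t - t\<bar> \<le> e + e' \<and> \<bar>x t - z ((l' \<circ> l) t)\<bar> \<le> e + e'"
    if "t \<in> {0..1}" for t
    using e[OF that] e'[OF time_change_mem[OF l that]] by auto
  ultimately show ?thesis unfolding skorokhod_close_def by blast
qed

lemma skorokhod_close_nonneg: "skorokhod_close x y e \<Longrightarrow> 0 \<le> e"
  by (auto simp: skorokhod_close_def dest!: bspec[of _ _ 0])

lemma skorokhod_close_exists:
  assumes "cadlag01 x" "cadlag01 y"
  shows "\<exists>e. skorokhod_close x y e"
proof -
  obtain B where B: "\<And>t. t \<in> {0..1} \<Longrightarrow> \<bar>x t\<bar> \<le> B" using cadlag01_bounded[OF assms(1)] by blast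
  obtain C where C: "\<And>t. t \<in> {0..1} \<Longrightarrow> \<bar>y t\<bar> \<le> C" using cadlag01_bounded[OF assms(2)] by blast
  have "0 \<le> B" "0 \<le> C" using B[of 0] C[of 0] by auto
  have "\<bar>x t - y t\<bar> \<le> B + C" if "t \<in> {0..1}" for t
    using B[OF that] C[OF that] by linarith
  with \<open>0 \<le> B\<close> \<open>0 \<le> C\<close> have "skorokhod_close x y (B + C)"
    unfolding skorokhod_close_def by (intro exI[of _ "\<lambda>t. t"]) (auto simp: time_change_id)
  then show ?thesis ..
qed

lemma skorokhod_close_separates:
  assumes x: "cadlag01 x" and y: "cadlag01 y" and cl: "\<And>e. e > 0 \<Longrightarrow> skorokhod_close x y e"
    and t: "t \<in> {0..1}"
  shows "x t = y t"
proof (rule ccontr)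
  assume ne: "x t \<noteq> y t"
  define c where "c = \<bar>x t - y t\<bar>"
  have c: "c > 0" using ne by (simp add: c_def)
  show False
  proof (cases "t < 1")
    case True
    then have "(x \<longlongrightarrow> x t) (at_right t)" "(y \<longlongrightarrow> y t) (at_right t)"
      using x y t by (auto simp: cadlag01_def)
    then have "\<forall>\<^sub>F s in at_right t. dist (x s) (x t) < c/4 \<and> dist (y s) (y t) < c/4"
      using c by (intro eventually_conj tendstoD) auto
    then obtain b where b: "b > t" "\<And>s. s > t \<Longrightarrow> s < b \<Longrightarrow> dist (x s) (x t) < c/4 \<and> dist (y s) (y t) < c/4"
      by (auto simp: eventually_at_right_field)
    define d where "d = min b 1 - t"
    have d: "d > 0" using b True by (auto simp: d_def)
    define e where "e = min (c/4) (d/4)"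
    have e: "e > 0" "e \<le> d/4" using c d by (auto simp: e_def)
    have "t + d \<le> b" by (simp add: d_def)
    obtain l where l: "time_change l"
      and le: "\<And>t. t \<in> {0..1} \<Longrightarrow> \<bar>l t - t\<bar> \<le> e \<and> \<bar>x t - y (l t)\<bar> \<le> e"
      using cl[OF e(1)] by (auto simp: skorokhod_close_def)
    define s where "s = t + d/2"
    have s: "s \<in> {0..1}" "s > t" "s < b" using d t by (auto simp: s_def d_def min_def field_simps)
    have "l s > t" "l s < b"
      using le[OF s(1)] d s_def \<open>e \<le> d/4\<close> \<open>t + d \<le> b\<close> by linarith+
    then have "dist (y (l s)) (y t) < c/4" using b by auto
    moreover have "dist (x s) (x t) < c/4" using b s by auto
    moreover have "\<bar>x s - y (l s)\<bar> \<le> c/4" using le[OF s(1)] by (auto simp: e_def)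
    ultimately have "\<bar>x t - y t\<bar> < c" using c unfolding dist_real_def by linarith
    then show False by (simp add: c_def)
  next
    case False
    then have "t = 1" using t by auto
    obtain l where l: "time_change l"
      and le: "\<And>t. t \<in> {0..1} \<Longrightarrow> \<bar>l t - t\<bar> \<le> c/2 \<and> \<bar>x t - y (l t)\<bar> \<le> c/2"
      using cl[of "c/2"] c by (auto simp: skorokhod_close_def)
    have "\<bar>x 1 - y 1\<bar> \<le> c/2" using le[of 1] time_change_1[OF l] by simp
    then show False using c \<open>t = 1\<close> by (simp add: c_def)
  qed
qed

instantiation D01 :: metric_space
begin

definition dist_D01 :: "D01 \<Rightarrow> D01 \<Rightarrow> real" where
  "dist_D01 x y = Inf {e. skorokhod_close (path_of x) (path_of y) e}"

definition uniformity_D01 :: "(D01 \<times> D01) filter" where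
  "uniformity_D01 = (INF e\<in>{0<..}. principal {(x, y). dist x y < e})"

definition open_D01 :: "D01 set \<Rightarrow> bool" where
  "open_D01 U \<longleftrightarrow> (\<forall>x\<in>U. \<forall>\<^sub>F (x', y) in uniformity. x' = x \<longrightarrow> y \<in> U)"

instance
proof
  define A where "A x y = {e. skorokhod_close (path_of x) (path_of y) e}" for x y
  have cad: "cadlag01 (path_of x)" for x using path_of[of x] by auto
  have A: "A x y \<noteq> {}" "bdd_below (A x y)" for x y
    using skorokhod_close_exists[OF cad[of x] cad[of y]] skorokhod_close_nonneg
    by (auto simp: A_def intro!: bdd_belowI[of _ 0])
  have dA: "dist x y = Inf (A x y)" for x y :: D01 by (simp add: dist_D01_def A_def)
  have less: "\<exists>e. skorokhod_close (path_of x) (path_of y) e \<and> e < r" if "dist x y < r" for x y :: D01 and r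
    using that cInf_less_iff[OF A] by (auto simp: dA A_def)
  have le: "dist x y \<le> e" if "skorokhod_close (path_of x) (path_of y) e" for x y :: D01 and e
    using that A by (auto simp: dA intro!: cInf_lower) (auto simp: A_def)
  have sym: "dist x y = dist y x" for x y :: D01
    unfolding dist_D01_def by (rule arg_cong[of _ _ Inf]) (blast intro: skorokhod_close_sym)
  have refl: "skorokhod_close (path_of x) (path_of x) 0" for x
    unfolding skorokhod_close_def by (auto intro!: exI[of _ "\<lambda>t. t"] time_change_id)
  have nonneg: "0 \<le> dist x y" for x y :: D01
    unfolding dA using A skorokhod_close_nonneg by (intro cInf_greatest) (auto simp: A_def)
  show "(dist x y = 0) = (x = y)" for x y :: D01
  proof
    assume 0: "dist x y = 0"
    have "skorokhod_close (path_of x) (path_of y) e" if e: "e > 0" for e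
    proof -
      obtain e' where "skorokhod_close (path_of x) (path_of y) e'" "e' < e"
        using less[of x y e] 0 e by auto
      then show ?thesis unfolding skorokhod_close_def by (meson less_imp_le order_trans)
    qed
    then have "path_of x t = path_of y t" if "t \<in> {0..1}" for t
      using skorokhod_close_separates[OF cad cad _ that] by blast
    moreover have "path_of x \<in> extensional {0..1}" "path_of y \<in> extensional {0..1}"
      using path_of[of x] path_of[of y] by auto
    ultimately have "path_of x = path_of y" by (rule extensionalityI[rotated 2])
    then show "x = y" by (simp add: path_of_inject)
  next
    assume "x = y"
    then show "dist x y = 0" using le[OF refl[of x]] nonneg[of x y] by simp
  qed
  show "dist x y \<le> dist x z + dist y z" for x y z :: D01
  proof (rule field_le_epsilon)
    fix e :: real assume "e > 0"
    then obtain e1 e2 where "skorokhod_close (path_of x) (path_of z) e1" "e1 < dist x z + e/2"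
      "skorokhod_close (path_of z) (path_of y) e2" "e2 < dist z y + e/2"
      using less[of x z "dist x z + e/2"] less[of z y "dist z y + e/2"] by auto
    then show "dist x y \<le> dist x z + dist y z + e"
      using le[OF skorokhod_close_trans] sym[of z y] by fastforce
  qed
qed (simp_all add: uniformity_D01_def open_D01_def)

end

definition converges_in_law ::
  "'a measure \<Rightarrow> ('i \<Rightarrow> 'a \<Rightarrow> 'b::topological_space) \<Rightarrow> 'b measure \<Rightarrow> 'i filter \<Rightarrow> bool" where
  "converges_in_law P X \<nu> G \<longleftrightarrow>
     (\<forall>\<^sub>F i in G. X i \<in> borel_measurable P) \<and>
     (\<forall>h :: 'b \<Rightarrow> real. continuous_on UNIV h \<and> bounded (range h) \<longrightarrow>
        ((\<lambda>i. \<integral>x. h x \<partial>(distr P borel (X i))) \<longlongrightarrow> (\<integral>x. h x \<partial>\<nu>)) G)"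


section \<open>Filtrations, martingales and compensators\<close>

text \<open>Processes are indexed by the nonnegative reals; values at negative times play no role.\<close>

definition augmented_filtration ::
  "'a measure \<Rightarrow> (real \<Rightarrow> 'a \<Rightarrow> real) \<Rightarrow> real \<Rightarrow> 'a measure" where
  "augmented_filtration M X t = sigma (space M)
     ({X s -` B \<inter> space M | s B. 0 \<le> s \<and> s \<le> t \<and> B \<in> sets borel} \<union> null_sets (completion M))"

definition is_martingale ::
  "'a measure \<Rightarrow> (real \<Rightarrow> 'a measure) \<Rightarrow> (real \<Rightarrow> 'a \<Rightarrow> real) \<Rightarrow> bool" where
  "is_martingale P F X \<longleftrightarrow>
     (\<forall>t\<ge>0. subalgebra P (F t) \<and> X t \<in> borel_measurable (F t) \<and> integrable P (X t)) \<and>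
     (\<forall>s t. 0 \<le> s \<and> s \<le> t \<longrightarrow> (AE \<omega> in P. real_cond_exp P (F s) (X t) \<omega> = X s \<omega>))"

definition predictable_sigma :: "'a set \<Rightarrow> (real \<Rightarrow> 'a measure) \<Rightarrow> (real \<times> 'a) measure" where
  "predictable_sigma \<Omega> F = sigma ({0..} \<times> \<Omega>)
     ({{0} \<times> A | A. A \<in> sets (F 0)} \<union> {{s<..t} \<times> A | s t A. 0 \<le> s \<and> s < t \<and> A \<in> sets (F s)})"

definition predictable :: "'a set \<Rightarrow> (real \<Rightarrow> 'a measure) \<Rightarrow> (real \<Rightarrow> 'a \<Rightarrow> real) \<Rightarrow> bool" where
  "predictable \<Omega> F X \<longleftrightarrow> (\<lambda>(t, \<omega>). X t \<omega>) \<in> borel_measurable (predictable_sigma \<Omega> F)"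

text \<open>As usual in the Doob--Meyer decomposition, increasing processes have right-continuous paths;
  without this the compensator would not be unique. The initial value of the process need not
  vanish, so the martingale need not start at zero.\<close>

definition is_compensator ::
  "'a measure \<Rightarrow> (real \<Rightarrow> 'a measure) \<Rightarrow> (real \<Rightarrow> 'a \<Rightarrow> real) \<Rightarrow> (real \<Rightarrow> 'a \<Rightarrow> real) \<Rightarrow> bool" where
  "is_compensator P F X L \<longleftrightarrow>
     predictable (space P) F L \<and>
     (AE \<omega> in P. L 0 \<omega> = 0 \<and> mono_on {0..} (\<lambda>t. L t \<omega>) \<and>
        (\<forall>t\<ge>0. ((\<lambda>u. L u \<omega>) \<longlongrightarrow> L t \<omega>) (at_right t))) \<and>
     is_martingale P F (\<lambda>t \<omega>. X t \<omega> - L t \<omega>)"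


section \<open>Renewal processes\<close>

text \<open>The interarrival times are indexed from 0, so \<open>\<tau> i\<close> is the time between
  the renewals number \<open>i\<close> and \<open>i + 1\<close>.\<close>

definition renewal_time :: "(nat \<Rightarrow> 'a \<Rightarrow> real) \<Rightarrow> nat \<Rightarrow> 'a \<Rightarrow> real" where
  "renewal_time \<tau> n \<omega> = (\<Sum>i<n. \<tau> i \<omega>)"

text \<open>The sum of the indicators of \<open>renewal_time \<tau> n \<omega> \<le> t\<close> over all \<open>n\<close>, the renewal
  at time zero included. On the null set where infinitely many renewals occur up to time \<open>t\<close>,
  the value is 0.\<close>

definition renewal_count :: "(nat \<Rightarrow> 'a \<Rightarrow> real) \<Rightarrow> real \<Rightarrow> 'a \<Rightarrow> nat" where
  "renewal_count \<tau> t \<omega> = card {n. renewal_time \<tau> n \<omega> \<le> t}"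

end

theory Submission
  imports Defs "HOL-Real_Asymp.Real_Asymp"
begin

text \<open>
  Write \<open>R t\<close> for the value at time \<open>t\<close> of the compensator minus its value at the last renewal
  before \<open>t\<close>, and \<open>G = - ln (1 - F)\<close> for the cumulative hazard function of the interarrival law.
  The classical formula says that \<open>R t\<close> is \<open>G\<close> evaluated at the age of the current interarrival
  interval. Since \<open>F\<close> is continuous, \<open>G (\<tau> n)\<close> has an exponential tail, and only about a
  constant times \<open>T\<close> renewals occur up to time \<open>T\<close>; hence the supremum of \<open>R\<close> over \<open>{0..T}\<close> is of
  logarithmic order and vanishes after division by any positive power of \<open>T\<close>.

  The proof does not identify the compensator. The upper bound
  \<open>R t \<le> const * G (\<tau> n)\<close> for \<open>S n \<le> t < S (n + 1)\<close> is enough, and it comes directly from the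
  martingale property (lemma \<open>compensator_increment_bound\<close>). Let \<open>s < t \<le> s + 1\<close> be deterministic
  times. On the event that \<open>s\<close> and \<open>t\<close> lie in the same interval \<open>[S n, S (n + 1))\<close>, every event of
  the filtration at time \<open>t\<close> is determined by the first \<open>n\<close> interarrival times
  (\<open>filtration_between_renewals\<close>). So if the increment of the compensator over \<open>(s, t]\<close> were large
  there, it would be large on an event \<open>C\<close> of the past of \<open>S n\<close>, intersected with \<open>t < S (n + 1)\<close>;
  the conditional probability of the latter given the past is \<open>1 - F (t - S n)\<close>. On the other side,
  the expected number of renewals in \<open>(s, t]\<close> on the same event \<open>C\<close> is at most a constant times the
  probability \<open>F (t - S n) - F (s - S n)\<close> of a first one (\<open>expected_new_renewals_le\<close>). Comparison
  yields \<open>(\<Lambda> t - \<Lambda> s) * (1 - F (t - S n)) \<le> const * (F (t - S n) - F (s - S n))\<close>, at first for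
  rational \<open>s\<close> and \<open>t\<close> outside of one null set and then for all by right continuity. This is a
  discrete form of \<open>d\<Lambda> \<le> const * dF / (1 - F)\<close> and integrates to the logarithm
  (\<open>increment_bound_by_log_survival\<close>).

  The statement about convergence in law also contains the assertion that the path is a random
  element of the Skorokhod space. This holds for every process with cadlag paths and measurable
  marginals, because step functions with countably many possible shapes, read off from the process
  on a grid, converge to the path in the Skorokhod metric (\<open>measurable_to_D01\<close>).
\<close>

section \<open>Random elements of the Skorokhod space\<close>

text \<open>One-sided limits make the oscillation small on each side of every point, so compactness of the
  interval leaves finitely many points across which the path can move by more than \<open>e\<close>. That two
  times lie in the same cell of the partition is expressed by comparing them with each \<open>j\<close>, which
  is the form in which a time change preserves it.\<close>

lemma cadlag01_finite_oscillation_partition: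
  assumes x: "cadlag01 x" and e: "e > 0"
  obtains J where "finite J" "J \<subseteq> {0<..1}"
    "\<And>s t. s \<in> {0..1} \<Longrightarrow> t \<in> {0..1} \<Longrightarrow> (\<forall>j\<in>J. j \<le> s \<longleftrightarrow> j \<le> t) \<Longrightarrow> \<bar>x s - x t\<bar> \<le> e"
proof -
  define P where "P a b \<longleftrightarrow> (\<exists>J. finite J \<and> J \<subseteq> {0<..1} \<and>
      (\<forall>s\<in>{a..b} \<inter> {0..1}. \<forall>t\<in>{a..b} \<inter> {0..1}. (\<forall>j\<in>J. j \<le> s \<longleftrightarrow> j \<le> t) \<longrightarrow> \<bar>x s - x t\<bar> \<le> e))"
    for a b :: real
  have "P 0 1"
  proof (rule Bolzano)
    fix a b c assume ab: "P a b" "P b c" "a \<le> b" "b \<le> c"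
    obtain J where J: "finite J" "J \<subseteq> {0<..1}"
      "\<forall>s\<in>{a..b} \<inter> {0..1}. \<forall>t\<in>{a..b} \<inter> {0..1}. (\<forall>j\<in>J. j \<le> s \<longleftrightarrow> j \<le> t) \<longrightarrow> \<bar>x s - x t\<bar> \<le> e"
      using ab(1) unfolding P_def by blast
    obtain K where K: "finite K" "K \<subseteq> {0<..1}"
      "\<forall>s\<in>{b..c} \<inter> {0..1}. \<forall>t\<in>{b..c} \<inter> {0..1}. (\<forall>j\<in>K. j \<le> s \<longleftrightarrow> j \<le> t) \<longrightarrow> \<bar>x s - x t\<bar> \<le> e"
      using ab(2) unfolding P_def by blast
    define L where "L = J \<union> K \<union> ({b} \<inter> {0<..1})"
    have "\<bar>x s - x t\<bar> \<le> e"
      if st: "s \<in> {a..c} \<inter> {0..1}" "t \<in> {a..c} \<inter> {0..1}" and L: "\<forall>j\<in>L. j \<le> s \<longleftrightarrow> j \<le> t" for s t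
    proof -
      have "b \<le> s \<longleftrightarrow> b \<le> t"
        using L st by (cases "b \<in> {0<..1}") (auto simp: L_def)
      then have "s \<in> {a..b} \<and> t \<in> {a..b} \<or> s \<in> {b..c} \<and> t \<in> {b..c}"
        using st by auto
      then show ?thesis
      proof
        assume "s \<in> {a..b} \<and> t \<in> {a..b}"
        then have "s \<in> {a..b} \<inter> {0..1}" "t \<in> {a..b} \<inter> {0..1}" using st by auto
        moreover have "\<forall>j\<in>J. j \<le> s \<longleftrightarrow> j \<le> t" using L by (simp add: L_def)
        ultimately show ?thesis using J(3) by blast
      next
        assume "s \<in> {b..c} \<and> t \<in> {b..c}"
        then have "s \<in> {b..c} \<inter> {0..1}" "t \<in> {b..c} \<inter> {0..1}" using st by auto
        moreover have "\<forall>j\<in>K. j \<le> s \<longleftrightarrow> j \<le> t" using L by (simp add: L_def)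
        ultimately show ?thesis using K(3) by blast
      qed
    qed
    moreover have "finite L" "L \<subseteq> {0<..1}" using J K by (auto simp: L_def)
    ultimately show "P a c" unfolding P_def by blast
  next
    fix t :: real assume t: "0 \<le> t" "t \<le> 1"
    have "\<exists>d>0. \<forall>s\<in>{t..<t+d} \<inter> {0..1}. \<bar>x s - x t\<bar> \<le> e/2"
    proof (cases "t < 1")
      case True
      then have "(x \<longlongrightarrow> x t) (at_right t)" using x t by (auto simp: cadlag01_def)
      then have "\<forall>\<^sub>F s in at_right t. dist (x s) (x t) < e/2" by (rule tendstoD) (use e in auto)
      then obtain b where "b > t" "\<And>s. s > t \<Longrightarrow> s < b \<Longrightarrow> dist (x s) (x t) < e/2"
        by (auto simp: eventually_at_right_field)
      then have "\<bar>x s - x t\<bar> \<le> e/2" if "s \<in> {t..<t + (b-t)} \<inter> {0..1}" for s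
        using that e by (cases "s = t") (auto simp: dist_real_def less_imp_le)
      with \<open>b > t\<close> show ?thesis by (intro exI[of _ "b - t"]) auto
    qed (use t e in \<open>auto intro!: exI[of _ 1]\<close>)
    then obtain d1 where 1: "d1 > 0" "\<forall>s\<in>{t..<t+d1} \<inter> {0..1}. \<bar>x s - x t\<bar> \<le> e/2" by auto
    have "\<exists>d>0. \<exists>l. \<forall>s\<in>{t-d<..<t} \<inter> {0..1}. \<bar>x s - l\<bar> \<le> e/2"
    proof (cases "t > 0")
      case True
      then obtain l where "(x \<longlongrightarrow> l) (at_left t)"
        using x t unfolding cadlag01_def by (meson greaterThanAtMost_iff)
      then have "\<forall>\<^sub>F s in at_left t. dist (x s) l < e/2" by (rule tendstoD) (use e in auto)
      then obtain b where "b < t" "\<And>s. s > b \<Longrightarrow> s < t \<Longrightarrow> dist (x s) l < e/2"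
        by (auto simp: eventually_at_left_field)
      then show ?thesis
        by (intro exI[of _ "t - b"] conjI exI[of _ l]) (force simp: dist_real_def)+
    qed (use t in \<open>auto intro!: exI[of _ 1]\<close>)
    then obtain d2 l where 2: "d2 > 0" "\<forall>s\<in>{t-d2<..<t} \<inter> {0..1}. \<bar>x s - l\<bar> \<le> e/2" by auto
    show "\<exists>d>0. \<forall>a b. a \<le> t \<and> t \<le> b \<and> b - a < d \<longrightarrow> P a b"
    proof (intro exI[of _ "min d1 d2"] conjI allI impI)
      fix a b assume ab: "a \<le> t \<and> t \<le> b \<and> b - a < min d1 d2"
      have "\<bar>x s - x r\<bar> \<le> e" if s: "s \<in> {a..b} \<inter> {0..1}" "r \<in> {a..b} \<inter> {0..1}"
        and *: "\<forall>j\<in>{t} \<inter> {0<..1}. j \<le> s \<longleftrightarrow> j \<le> r" for s r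
      proof -
        have "t \<le> s \<longleftrightarrow> t \<le> r" using * t s by (cases "t > 0") auto
        then consider "t \<le> s" "t \<le> r" | "s < t" "r < t" by linarith
        then show ?thesis
        proof cases
          case 1
          then have "\<bar>x s - x t\<bar> \<le> e/2" "\<bar>x r - x t\<bar> \<le> e/2"
            using \<open>\<forall>s\<in>{t..<t+d1} \<inter> {0..1}. _ s\<close> s ab by auto
          then show ?thesis by linarith
        next
          case 2
          then have "\<bar>x s - l\<bar> \<le> e/2" "\<bar>x r - l\<bar> \<le> e/2"
            using \<open>\<forall>s\<in>{t-d2<..<t} \<inter> {0..1}. _ s\<close> s ab by auto
          then show ?thesis by linarith
        qed
      qed
      then show "P a b" unfolding P_def by (intro exI[of _ "{t} \<inter> {0<..1}"]) auto
    qed (use 1 2 in auto)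
  qed auto
  then show ?thesis using that unfolding P_def by auto
qed

text \<open>Add to the identity a multiple of a hat function around each point to be moved. The hats
  vanish at the other points and at the endpoints, and they are Lipschitz; for small displacements
  the perturbation is then a contraction, so that the sum stays strictly increasing.\<close>

lemma time_change_moving_points:
  assumes J: "finite J" "J \<subseteq> {0<..<1}" and e: "e > 0"
  obtains r where "r > 0"
    "\<And>c. (\<And>j. j \<in> J \<Longrightarrow> \<bar>c j - j\<bar> \<le> r) \<Longrightarrow>
       \<exists>l. time_change l \<and> (\<forall>j\<in>J. l j = c j) \<and> (\<forall>t\<in>{0..1}. \<bar>l t - t\<bar> \<le> e)"
proof -
  have "\<exists>g>0. \<forall>i\<in>insert 0 (insert 1 J). \<forall>j\<in>insert 0 (insert 1 J). i \<noteq> j \<longrightarrow> g \<le> \<bar>i - j\<bar>"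
  proof -
    define G where "G = (\<lambda>(i, j). \<bar>i - j\<bar>) ` {(i, j) \<in> insert 0 (insert 1 J) \<times> insert 0 (insert 1 J). i \<noteq> j}"
    have fin: "finite G" unfolding G_def using J
      by (intro finite_imageI) (rule finite_subset[of _ "insert 0 (insert 1 J) \<times> insert 0 (insert 1 J)"], auto)
    have "\<bar>0 - 1 :: real\<bar> \<in> G" unfolding G_def by (rule image_eqI[of _ _ "(0, 1)"]) auto
    then have ne: "G \<noteq> {}" by auto
    have "0 < Min G" using fin ne by (subst Min_gr_iff) (auto simp: G_def)
    moreover have "Min G \<le> \<bar>i - j\<bar>"
      if "i \<in> insert 0 (insert 1 J)" "j \<in> insert 0 (insert 1 J)" "i \<noteq> j" for i j
      using fin that by (intro Min_le) (auto simp: G_def intro!: image_eqI[of _ _ "(i, j)"])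
    ultimately show ?thesis by blast
  qed
  then obtain g where g: "g > 0"
    "\<And>i j. i \<in> insert 0 (insert 1 J) \<Longrightarrow> j \<in> insert 0 (insert 1 J) \<Longrightarrow> i \<noteq> j \<Longrightarrow> g \<le> \<bar>i - j\<bar>" by blast
  define hat where "hat j t = max 0 (1 - \<bar>t - j\<bar> / g)" for j t :: real
  have hat_bounds: "0 \<le> hat j t" "hat j t \<le> 1" for j t using g by (auto simp: hat_def)
  have hat_lip: "\<bar>hat j t - hat j s\<bar> \<le> \<bar>t - s\<bar> / g" for j s t
  proof -
    have "\<bar>hat j t - hat j s\<bar> \<le> \<bar>\<bar>t - j\<bar> / g - \<bar>s - j\<bar> / g\<bar>" unfolding hat_def by linarith
    also have "\<dots> = \<bar>\<bar>t - j\<bar> - \<bar>s - j\<bar>\<bar> / g" using g by (simp add: diff_divide_distrib[symmetric])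
    also have "\<dots> \<le> \<bar>t - s\<bar> / g" using g by (intro divide_right_mono) auto
    finally show ?thesis .
  qed
  have hat_self: "hat j j = 1" for j by (simp add: hat_def)
  have hat_other: "hat j i = 0" if "i \<in> insert 0 (insert 1 J)" "j \<in> J" "i \<noteq> j" for i j
    using g(2)[of i j] that g(1) by (auto simp: hat_def field_simps)
  \<comment> \<open>The displacements together are at most \<open>g / 2\<close>, half of the reciprocal Lipschitz constant of the hats, and at most \<open>e\<close>.\<close>
  define r where "r = min e (g / 2) / (real (card J) + 1)"
  have r: "r > 0" using e g by (auto simp: r_def)
  have kr: "real (card J) * r \<le> min e (g/2)"
  proof -
    have "real (card J) * r \<le> (real (card J) + 1) * r" using r by (intro mult_right_mono) auto
    also have "\<dots> = min e (g/2)" by (simp add: r_def)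
    finally show ?thesis .
  qed
  show ?thesis
  proof (rule that[of r])
    fix c assume c: "\<And>j. j \<in> J \<Longrightarrow> \<bar>c j - j\<bar> \<le> r"
    define l where "l t = t + (\<Sum>j\<in>J. (c j - j) * hat j t)" for t
    have lip: "\<bar>(l t - t) - (l s - s)\<bar> \<le> \<bar>t - s\<bar> / 2" for s t
    proof -
      have "\<bar>(l t - t) - (l s - s)\<bar> = \<bar>\<Sum>j\<in>J. (c j - j) * (hat j t - hat j s)\<bar>"
        by (simp add: l_def sum_subtractf right_diff_distrib)
      also have "\<dots> \<le> (\<Sum>j\<in>J. r * (\<bar>t - s\<bar> / g))"
        by (rule order_trans[OF sum_abs], rule sum_mono, unfold abs_mult)
          (intro mult_mono c hat_lip, use r in auto)
      also have "\<dots> = (real (card J) * r) * (\<bar>t - s\<bar> / g)" by simp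
      also have "\<dots> \<le> (g/2) * (\<bar>t - s\<bar> / g)" using kr g by (intro mult_right_mono) auto
      also have "\<dots> = \<bar>t - s\<bar> / 2" using g by simp
      finally show ?thesis .
    qed
    have l01: "l 0 = 0" "l 1 = 1"
    proof -
      have "(\<Sum>j\<in>J. (c j - j) * hat j i) = 0" if "i = 0 \<or> i = 1" for i
        using that J hat_other[of i] by (intro sum.neutral) auto
      then show "l 0 = 0" "l 1 = 1" by (auto simp: l_def)
    qed
    have mono: "l s < l t" if "s < t" for s t
      
    proof -
      have "\<bar>(l t - t) - (l s - s)\<bar> \<le> (t - s) / 2" using lip[of t s] that by simp
      then have "- ((t - s) / 2) \<le> (l t - t) - (l s - s)" by (rule abs_le_D2[THEN iffD1[OF minus_le_iff]])
      then show ?thesis using that by (simp add: field_simps)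
    qed
    have cont: "continuous_on {0..1} l"
      unfolding l_def hat_def using g by (intro continuous_intros) auto
    have "l ` {0..1} = {0..1}"
    proof
      show "l ` {0..1} \<subseteq> {0..1}" using mono[of 0] mono[of _ 1] l01
        by (force simp: le_less)
      show "{0..1} \<subseteq> l ` {0..1}" using IVT'[of l 0 _ 1] cont l01 by (fastforce simp: image_iff)
    qed
    then have "time_change l" using mono cont by (auto simp: time_change_def strict_mono_on_def)
    moreover have "l i = c i" if i: "i \<in> J" for i
    proof -
      have "(\<Sum>j\<in>J. (c j - j) * hat j i) = (\<Sum>j\<in>J. if j = i then c i - i else 0)"
        using i hat_other[of i] by (intro sum.cong) (auto simp: hat_self)
      then show ?thesis using i J by (simp add: l_def)
    qed
    moreover have "\<bar>l t - t\<bar> \<le> e" for t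
    proof -
      have "\<bar>l t - t\<bar> \<le> (\<Sum>j\<in>J. r * 1)"
        unfolding l_def add_diff_cancel_left'
        by (rule order_trans[OF sum_abs], rule sum_mono, unfold abs_mult)
          (intro mult_mono c, use hat_bounds r in \<open>auto simp: less_imp_le\<close>)
      then show ?thesis using kr by simp
    qed
    ultimately show "\<exists>l. time_change l \<and> (\<forall>j\<in>J. l j = c j) \<and> (\<forall>t\<in>{0..1}. \<bar>l t - t\<bar> \<le> e)" by blast
  qed (rule r)
qed

lemma dist_D01_le: "skorokhod_close (path_of x) (path_of y) e \<Longrightarrow> dist x y \<le> e"
  unfolding dist_D01_def
  by (rule cInf_lower) (auto intro!: bdd_belowI[of _ 0] skorokhod_close_nonneg)

lemma cadlag01_cong:
  assumes "\<And>t. t \<in> {0..1} \<Longrightarrow> x t = y t"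
  shows "cadlag01 x = cadlag01 y"
proof -
  have "(x \<longlongrightarrow> x t) (at_right t) \<longleftrightarrow> (y \<longlongrightarrow> y t) (at_right t)" if "t \<in> {0..<1}" for t
  proof -
    have "\<forall>\<^sub>F s in at_right t. x s = y s"
      using that assms by (auto simp: eventually_at_right_field intro!: exI[of _ 1])
    then show ?thesis using that assms[of t] by (auto intro: tendsto_cong[THEN iffD1] simp: tendsto_cong)
  qed
  moreover have "(x \<longlongrightarrow> l) (at_left t) \<longleftrightarrow> (y \<longlongrightarrow> l) (at_left t)" if "t \<in> {0<..1}" for t l
    using that assms by (intro filterlim_cong) (auto simp: eventually_at_left_field intro!: exI[of _ 0])
  ultimately show ?thesis by (simp add: cadlag01_def)
qed

lemma path_of_to_D01:
  assumes "cadlag01 x"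
  shows "path_of (to_D01 x) = restrict x {0..1}"
proof -
  have "cadlag01 (restrict x {0..1})" using assms cadlag01_cong[of "restrict x {0..1}" x] by simp
  then show ?thesis using assms by (auto simp: to_D01_def intro!: Abs_D01_inverse)
qed

lemma cadlag01_const: "cadlag01 (\<lambda>_. c)"
  by (auto simp: cadlag01_def intro!: exI[of _ c])

lemma dist_to_D01_le:
  assumes "cadlag01 x" "cadlag01 y" "time_change l"
    and "\<And>t. t \<in> {0..1} \<Longrightarrow> \<bar>l t - t\<bar> \<le> e" "\<And>t. t \<in> {0..1} \<Longrightarrow> \<bar>x t - y (l t)\<bar> \<le> e"
  shows "dist (to_D01 x) (to_D01 y) \<le> e"
proof (rule dist_D01_le)
  show "skorokhod_close (path_of (to_D01 x)) (path_of (to_D01 y)) e"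
    using assms time_change_mem[OF assms(3)]
    by (auto simp: skorokhod_close_def path_of_to_D01 intro!: exI[of _ l])
qed

text \<open>The values on the grid of mesh \<open>1 / n\<close> are integer multiples of \<open>1 / n\<close>: on the unit interval
  there are only countably many such functions, and measurability of a random one is a question
  about countably many events.\<close>

definition step_approx :: "nat \<Rightarrow> (nat \<Rightarrow> int) \<Rightarrow> real \<Rightarrow> real" where
  "step_approx n k t = of_int (k (nat \<lfloor>real n * t\<rfloor>)) / real n"

lemma cadlag01_step_approx:
  assumes "n > 0" shows "cadlag01 (step_approx n k)"
proof -
  have "\<forall>\<^sub>F s in at_right t. step_approx n k s = step_approx n k t" for t
  proof -
    have "\<lfloor>real n * s\<rfloor> = \<lfloor>real n * t\<rfloor>" if "t < s" "s < (of_int \<lfloor>real n * t\<rfloor> + 1) / real n" for s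
      using that assms by (intro floor_unique) (auto simp: field_simps intro: order_trans[OF of_int_floor_le])
    moreover have "t < (of_int \<lfloor>real n * t\<rfloor> + 1) / real n"
    proof -
      have "real n * t < of_int \<lfloor>real n * t\<rfloor> + 1" by linarith
      then show ?thesis using assms by (simp add: field_simps)
    qed
    ultimately show ?thesis unfolding eventually_at_right_field step_approx_def by metis
  qed
  moreover have "\<exists>l. \<forall>\<^sub>F s in at_left t. step_approx n k s = l" for t
  proof -
    have "\<lfloor>real n * s\<rfloor> = \<lceil>real n * t\<rceil> - 1" if "s < t" "(of_int \<lceil>real n * t\<rceil> - 1) / real n < s" for s
    proof (rule floor_unique)
      have "real n * s < real n * t" using that assms by simp
      then show "real n * s < of_int (\<lceil>real n * t\<rceil> - 1) + 1" by linarith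
    qed (use that assms in \<open>auto simp: field_simps\<close>)
    moreover have "(of_int \<lceil>real n * t\<rceil> - 1) / real n < t"
    proof -
      have "of_int \<lceil>real n * t\<rceil> - 1 < real n * t" by linarith
      then show ?thesis using assms by (simp add: field_simps)
    qed
    ultimately show ?thesis unfolding eventually_at_left_field step_approx_def by metis
  qed
  ultimately show ?thesis
    unfolding cadlag01_def using tendsto_eventually by blast
qed

text \<open>The time change moves each point \<open>j\<close> of an oscillation partition to the next grid point. Then a
  time \<open>t\<close> lies to the right of \<open>j\<close> exactly if the grid point below its image does, so the
  step function compares two values of the path in the same cell.\<close>

lemma step_approx_tendsto:
  assumes x: "cadlag01 x"
  shows "(\<lambda>n. to_D01 (step_approx n (\<lambda>k. \<lfloor>real n * x (real k / real n)\<rfloor>))) \<longlonglongrightarrow> to_D01 x"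
proof (rule metric_LIMSEQ_I)
  fix e :: real assume e: "e > 0"
  obtain J where J: "finite J" "J \<subseteq> {0<..1}"
    and osc: "\<And>s t. s \<in> {0..1} \<Longrightarrow> t \<in> {0..1} \<Longrightarrow> (\<forall>j\<in>J. j \<le> s \<longleftrightarrow> j \<le> t) \<Longrightarrow> \<bar>x s - x t\<bar> \<le> e/4"
    using cadlag01_finite_oscillation_partition[OF x, of "e/4"] e by auto
  obtain r where r: "r > 0"
    and tc: "\<And>c. (\<And>j. j \<in> J - {1} \<Longrightarrow> \<bar>c j - j\<bar> \<le> r) \<Longrightarrow>
       \<exists>l. time_change l \<and> (\<forall>j\<in>J - {1}. l j = c j) \<and> (\<forall>t\<in>{0..1}. \<bar>l t - t\<bar> \<le> e/2)"
  proof (rule time_change_moving_points[of "J - {1}" "e/2"])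
    show "finite (J - {1})" "J - {1} \<subseteq> {0<..<1}" "e / 2 > 0" using J e by (auto simp: less_le)
  qed blast
  obtain n0 :: nat where n0: "1 / r < real n0" "4 / e < real n0"
    using reals_Archimedean2[of "max (1/r) (4/e)"] by auto
  show "\<exists>n0. \<forall>n\<ge>n0. dist (to_D01 (step_approx n (\<lambda>k. \<lfloor>real n * x (real k / real n)\<rfloor>))) (to_D01 x) < e"
  proof (intro exI allI impI)
    fix n assume "n \<ge> n0"
    then have "1 / r < real n" "4 / e < real n" using n0 by linarith+
    moreover have "0 < 1 / r" using r by simp
    ultimately have "n > 0" by (cases n) auto
    with \<open>1 / r < real n\<close> \<open>4 / e < real n\<close> have n: "n > 0" "1 / real n < r" "1 / real n < e/4"
      using r e by (simp_all add: divide_less_eq mult.commute)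
    define c where "c j = of_int \<lceil>real n * j\<rceil> / real n" for j :: real
    have "\<bar>c j - j\<bar> \<le> r" for j
    proof -
      have "\<bar>c j - j\<bar> = \<bar>of_int \<lceil>real n * j\<rceil> - real n * j\<bar> / real n"
        using n by (simp add: c_def field_simps abs_if)
      also have "\<dots> \<le> 1 / real n" by (intro divide_right_mono) linarith+
      finally show ?thesis using n by simp
    qed
    then obtain l where l: "time_change l" "\<forall>j\<in>J - {1}. l j = c j" "\<forall>t\<in>{0..1}. \<bar>l t - t\<bar> \<le> e/2"
      using tc by blast
    have lc: "l j = c j" if "j \<in> J" for j
      using that l(2) time_change_1[OF l(1)] n by (cases "j = 1") (auto simp: c_def)
    have "\<bar>x t - step_approx n (\<lambda>k. \<lfloor>real n * x (real k / real n)\<rfloor>) (l t)\<bar> \<le> e/2" if t: "t \<in> {0..1}" for t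
    proof -
      define g where "g = of_int \<lfloor>real n * l t\<rfloor> / real n"
      have lt: "l t \<in> {0..1}" using time_change_mem[OF l(1) t] .
      have fl: "\<lfloor>real n * l t\<rfloor> \<ge> 0" "\<lfloor>real n * l t\<rfloor> \<le> int n"
        using lt by (auto simp: floor_le_iff) (smt (verit) mult_left_le of_nat_0_le_iff)
      have g: "g \<in> {0..1}" using fl n by (auto simp: g_def field_simps)
      have "j \<le> t \<longleftrightarrow> j \<le> g" if j: "j \<in> J" for j
      proof -
        have "j \<in> {0..1}" using J j by auto
        then have "j \<le> t \<longleftrightarrow> l j \<le> l t"
          using l(1) t strict_mono_on_leD[of "{0..1}" l j t] strict_mono_onD[of "{0..1}" l t j]
          by (auto simp: time_change_def not_less[symmetric])
        also have "\<dots> \<longleftrightarrow> \<lceil>real n * j\<rceil> \<le> \<lfloor>real n * l t\<rfloor>"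
          using n by (simp add: lc[OF j] c_def le_floor_iff field_simps)
        also have "\<dots> \<longleftrightarrow> j \<le> g" using n by (simp add: g_def ceiling_le_iff field_simps)
        finally show ?thesis .
      qed
      then have 1: "\<bar>x t - x g\<bar> \<le> e/4" using osc[OF t g] by auto
      have "step_approx n (\<lambda>k. \<lfloor>real n * x (real k / real n)\<rfloor>) (l t) = of_int \<lfloor>real n * x g\<rfloor> / real n"
        using fl by (simp add: step_approx_def g_def)
      moreover have "\<bar>x g - of_int \<lfloor>real n * x g\<rfloor> / real n\<bar> \<le> 1 / real n"
      proof -
        have "\<bar>x g - of_int \<lfloor>real n * x g\<rfloor> / real n\<bar> = \<bar>real n * x g - of_int \<lfloor>real n * x g\<rfloor>\<bar> / real n"
          using n by (simp add: field_simps abs_if)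
        also have "\<dots> \<le> 1 / real n" by (intro divide_right_mono) linarith+
        finally show ?thesis .
      qed
      ultimately show ?thesis using 1 n by linarith
    qed
    then have "dist (to_D01 x) (to_D01 (step_approx n (\<lambda>k. \<lfloor>real n * x (real k / real n)\<rfloor>))) \<le> e/2"
      using l x n by (intro dist_to_D01_le cadlag01_step_approx) auto
    then show "dist (to_D01 (step_approx n (\<lambda>k. \<lfloor>real n * x (real k / real n)\<rfloor>))) (to_D01 x) < e"
      using e by (simp add: dist_commute)
  qed
qed

text \<open>The metric of the Skorokhod space makes no reference to a countable family of functionals;
  measurability is instead inherited from the step approximations, which factor through the
  countable type of integer lists.\<close>

lemma measurable_to_D01:
  assumes meas: "\<And>v. v \<in> {0..1} \<Longrightarrow> (\<lambda>\<omega>. X v \<omega>) \<in> borel_measurable M"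
    and cad: "\<And>\<omega>. \<omega> \<in> space M \<Longrightarrow> cadlag01 (\<lambda>v. X v \<omega>)"
  shows "(\<lambda>\<omega>. to_D01 (\<lambda>v. X v \<omega>)) \<in> borel_measurable M"
proof (rule borel_measurable_LIMSEQ_metric)
  fix \<omega> assume "\<omega> \<in> space M"
  then show "(\<lambda>n. to_D01 (step_approx n (\<lambda>k. \<lfloor>real n * X (real k / real n) \<omega>\<rfloor>))) \<longlonglongrightarrow> to_D01 (\<lambda>v. X v \<omega>)"
    using step_approx_tendsto[OF cad] by simp
next
  fix n
  show "(\<lambda>\<omega>. to_D01 (step_approx n (\<lambda>k. \<lfloor>real n * X (real k / real n) \<omega>\<rfloor>))) \<in> borel_measurable M"
  proof (cases "n = 0")
    case True
    then show ?thesis by (simp add: step_approx_def)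
  next
    case n: False
    define K where "K \<omega> = map (\<lambda>k. \<lfloor>real n * X (real k / real n) \<omega>\<rfloor>) [0..<Suc n]" for \<omega>
    define G where "G ks = to_D01 (step_approx n (\<lambda>k. ks ! k))" for ks :: "int list"
    have nth: "\<lfloor>real n * X (real k / real n) \<omega>\<rfloor> = K \<omega> ! k" if "k \<le> n" for k \<omega>
      using that by (simp add: K_def del: upt_Suc)
    have "to_D01 (step_approx n (\<lambda>k. \<lfloor>real n * X (real k / real n) \<omega>\<rfloor>)) = G (K \<omega>)" for \<omega>
    proof -
      have "step_approx n (\<lambda>k. \<lfloor>real n * X (real k / real n) \<omega>\<rfloor>) t = step_approx n (\<lambda>k. K \<omega> ! k) t"
        if "t \<in> {0..1}" for t
      proof -
        have "real n * t \<le> real n" using that by (simp add: mult_left_le)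
        then have "nat \<lfloor>real n * t\<rfloor> \<le> n" by linarith
        then show ?thesis by (simp add: step_approx_def nth)
      qed
      then show ?thesis
        using n by (simp add: to_D01_def G_def cadlag01_step_approx cong: restrict_cong)
    qed
    moreover have "K \<in> measurable M (count_space UNIV)"
      unfolding measurable_count_space_eq2_countable
    proof (intro conjI ballI)
      fix ks :: "int list"
      have eq: "K \<omega> = ks \<longleftrightarrow> length ks = Suc n \<and> (\<forall>k\<in>{..n}. \<lfloor>real n * X (real k / real n) \<omega>\<rfloor> = ks ! k)" for \<omega>
        unfolding nth_equalityI[of "K \<omega>" ks] list_eq_iff_nth_eq
        by (auto simp: nth less_Suc_eq_le) (auto simp: K_def)
      have [measurable]: "(\<lambda>\<omega>. X (real k / real n) \<omega>) \<in> borel_measurable M" if "k \<in> {..n}" for k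
        using n that by (intro meas) auto
      have "{\<omega>\<in>space M. length ks = Suc n \<and> (\<forall>k\<in>{..n}. \<lfloor>real n * X (real k / real n) \<omega>\<rfloor> = ks ! k)} \<in> sets M"
        by measurable
      then show "K -` {ks} \<inter> space M \<in> sets M" by (simp add: eq vimage_def Int_def conj_commute)
    qed auto
    ultimately show ?thesis
      using measurable_compose[of K M "count_space UNIV" G borel] by simp
  qed
qed

text \<open>Convergence in probability to a constant implies convergence in law. The exceptional events
  \<open>A i\<close> spare the measurability of the distance.\<close>

lemma converges_in_law_const:
  fixes X :: "'i \<Rightarrow> 'a \<Rightarrow> 'b :: metric_space"
  assumes "prob_space P"
    and meas: "\<forall>\<^sub>F i in G. X i \<in> borel_measurable P"
    and conv: "\<And>e. e > 0 \<Longrightarrow> \<exists>A. (\<forall>\<^sub>F i in G. A i \<in> sets P \<and> (AE \<omega> in P. \<omega> \<notin> A i \<longrightarrow> dist (X i \<omega>) c \<le> e)) \<and>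
        ((\<lambda>i. measure P (A i)) \<longlongrightarrow> 0) G"
  shows "converges_in_law P X (return borel c) G"
  unfolding converges_in_law_def
proof (intro conjI allI impI meas)
  interpret prob_space P by fact
  fix h :: "'b \<Rightarrow> real" assume h: "continuous_on UNIV h \<and> bounded (range h)"
  then have [measurable]: "h \<in> borel_measurable borel" by (intro borel_measurable_continuous_onI) simp
  obtain B where B: "\<And>x. \<bar>h x\<bar> \<le> B" using h by (auto simp: bounded_iff)
  then have "B \<ge> 0" using B[of c] by linarith
  show "((\<lambda>i. \<integral>x. h x \<partial>distr P borel (X i)) \<longlongrightarrow> (\<integral>x. h x \<partial>return borel c)) G"
  proof (rule tendstoI)
    fix e :: real assume e: "e > 0"
    obtain d where d: "d > 0" "\<And>x. dist x c < d \<Longrightarrow> dist (h x) (h c) < e/2"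
      using h e unfolding continuous_on_iff by (metis UNIV_I half_gt_zero)
    obtain A where A: "\<forall>\<^sub>F i in G. A i \<in> sets P \<and> (AE \<omega> in P. \<omega> \<notin> A i \<longrightarrow> dist (X i \<omega>) c \<le> d/2)"
      "((\<lambda>i. measure P (A i)) \<longlongrightarrow> 0) G" using conv[of "d/2"] d by auto
    have "\<forall>\<^sub>F i in G. measure P (A i) < e / (4 * (B + 1))"
      using A(2) e \<open>B \<ge> 0\<close> by (intro order_tendstoD) auto
    with A(1) meas show "\<forall>\<^sub>F i in G. dist (\<integral>x. h x \<partial>distr P borel (X i)) (\<integral>x. h x \<partial>return borel c) < e"
    proof eventually_elim
      case (elim i)
      then have [measurable]: "X i \<in> borel_measurable P" "A i \<in> sets P" by auto
      have int: "integrable P (\<lambda>\<omega>. h (X i \<omega>))"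
        by (rule integrable_const_bound[of _ B]) (auto simp: B)
      have "dist (\<integral>x. h x \<partial>distr P borel (X i)) (\<integral>x. h x \<partial>return borel c) = \<bar>\<integral>\<omega>. h (X i \<omega>) - h c \<partial>P\<bar>"
        using int by (simp add: integral_distr integral_return dist_real_def prob_space)
      also have "\<dots> \<le> (\<integral>\<omega>. e/2 + 2 * B * indicator (A i) \<omega> \<partial>P)"
      proof (rule order_trans[OF integral_abs_bound], rule integral_mono_AE)
        show "AE \<omega> in P. \<bar>h (X i \<omega>) - h c\<bar> \<le> e/2 + 2 * B * indicator (A i) \<omega>"
          using conjunct2[OF elim(1)]
        proof eventually_elim
          case (elim \<omega>)
          show ?case
          proof (cases "\<omega> \<in> A i")
            case True
            then show ?thesis using B[of "X i \<omega>"] B[of c] e by auto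
          next
            case False
            then show ?thesis using elim d(2)[of "X i \<omega>"] d(1) by (auto simp: dist_real_def)
          qed
        qed
      qed (use int in \<open>auto intro!: integrable_add integrable_diff integrable_abs integrable_mult_right integrable_real_indicator simp: less_top[symmetric]\<close>)
      also have "\<dots> = e/2 + 2 * B * measure P (A i)"
        by (subst Bochner_Integration.integral_add) (auto simp: prob_space less_top[symmetric])
      also have "\<dots> < e"
      proof -
        have "2 * B * measure P (A i) \<le> 2 * B * (e / (4 * (B + 1)))"
          using elim \<open>B \<ge> 0\<close> by (intro mult_left_mono) auto
        also have "\<dots> < e/2" using \<open>B \<ge> 0\<close> e by (simp add: field_simps)
        finally show ?thesis by linarith
      qed
      finally show ?case .
    qed
  qed
qed

section \<open>Real analysis and distribution functions\<close>

text \<open>The integrated form of \<open>dg \<le> K * dF / (1 - F)\<close>. Locally \<open>1 - F\<close> changes at most by a factor of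
  two by continuity, and there \<open>r - 1 \<le> 2 * ln r\<close> for the ratio \<open>r\<close> of its values; Bolzano's
  principle adds up the local bounds.\<close>

lemma increment_bound_by_log_survival:
  fixes g F :: "real \<Rightarrow> real"
  assumes mono: "mono F" and cont: "\<And>x. isCont F x" and ab: "a \<le> b" and Fb: "F b < 1" and K: "0 \<le> K"
    and step: "\<And>s t. a \<le> s \<Longrightarrow> s < t \<Longrightarrow> t \<le> b \<Longrightarrow> t < s + 1 \<Longrightarrow> (g t - g s) * (1 - F t) \<le> K * (F t - F s)"
  shows "g b - g a \<le> 2 * K * (ln (1 - F a) - ln (1 - F b))"
proof -
  define Q where "Q x y \<longleftrightarrow> (a \<le> x \<and> x \<le> y \<and> y \<le> b \<longrightarrow> g y - g x \<le> 2 * K * (ln (1 - F x) - ln (1 - F y)))" for x y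
  have "Q a b"
  proof (rule Bolzano[OF ab])
    fix x y z assume "Q x y" "Q y z" "x \<le> y" "y \<le> z"
    then show "Q x z" by (auto simp: Q_def right_diff_distrib)
  next
    fix t assume t: "a \<le> t" "t \<le> b"
    define e where "e = (1 - F b) / 4"
    have e: "e > 0" using Fb by (simp add: e_def)
    then obtain d where d: "d > 0" "\<And>u. \<bar>u - t\<bar> < d \<Longrightarrow> \<bar>F u - F t\<bar> < e"
      using cont[of t] unfolding continuous_at_eps_delta dist_real_def by blast
    show "\<exists>d>0. \<forall>x y. x \<le> t \<and> t \<le> y \<and> y - x < d \<longrightarrow> Q x y"
    proof (intro exI[of _ "min d 1"] conjI allI impI)
      fix x y assume xy: "x \<le> t \<and> t \<le> y \<and> y - x < min d 1"
      show "Q x y" unfolding Q_def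
      proof
        assume ord: "a \<le> x \<and> x \<le> y \<and> y \<le> b"
        show "g y - g x \<le> 2 * K * (ln (1 - F x) - ln (1 - F y))"
        proof (cases "x = y")
          case False
          have Fxy: "F x \<le> F y" "F y \<le> F b" using mono ord by (auto dest: monoD)
          have pos: "1 - F y > 0" "1 - F x > 0" using Fxy Fb by auto
          have "\<bar>F x - F t\<bar> < e" "\<bar>F y - F t\<bar> < e" using xy by (auto intro!: d(2))
          then have "F y - F x \<le> 2 * e" by linarith
          also have "\<dots> \<le> 1 - F y" using Fxy Fb by (simp add: e_def)
          finally have small: "F y - F x \<le> 1 - F y" .
          define r where "r = (1 - F x) / (1 - F y)"
          have r: "1 \<le> r" "r \<le> 2" using Fxy small pos by (auto simp: r_def field_simps)
          have "ln (1 / r) \<le> 1 / r - 1" using r by (intro ln_le_minus_one) auto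
          then have "1 - 1 / r \<le> ln r" using r by (simp add: ln_div)
          moreover have "(r - 1) / 2 \<le> 1 - 1 / r"
          proof -
            have "(r - 1) / 2 \<le> (r - 1) / r" using r by (intro divide_left_mono) auto
            then show ?thesis using r by (simp add: diff_divide_distrib)
          qed
          ultimately have "(r - 1) / 2 \<le> ln r" by (rule order_trans[rotated])
          then have "r - 1 \<le> 2 * ln r" by simp
          have "(g y - g x) * (1 - F y) \<le> K * (F y - F x)"
            using ord xy False by (intro step) auto
          then have "g y - g x \<le> K * (F y - F x) / (1 - F y)" using pos by (simp add: le_divide_eq)
          also have "\<dots> = K * (r - 1)" using pos by (simp add: r_def field_simps)
          also have "\<dots> \<le> K * (2 * ln r)" using K \<open>r - 1 \<le> 2 * ln r\<close> by (intro mult_left_mono)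
          also have "\<dots> = 2 * K * (ln (1 - F x) - ln (1 - F y))" using pos by (simp add: r_def ln_div)
          finally show ?thesis .
        qed simp
      qed
    qed (use d in auto)
  qed
  then show ?thesis using ab by (simp add: Q_def)
qed

lemma rational_sequence_at_right:
  fixes x y :: real
  assumes "x < y"
  obtains q where "\<And>k :: nat. q k \<in> \<rat>" "\<And>k. x < q k" "\<And>k. q k < y" "filterlim q (at_right x) sequentially"
proof -
  have "\<exists>r\<in>\<rat>. x < r \<and> r < min y (x + 1 / real (Suc k))" for k
    using assms by (intro Rats_dense_in_real) auto
  then obtain q where q: "\<And>k. q k \<in> \<rat>" "\<And>k. x < q k" "\<And>k. q k < min y (x + 1 / real (Suc k))" by metis
  have "q \<longlonglongrightarrow> x"
  proof (rule tendsto_sandwich[of "\<lambda>_. x" q _ "\<lambda>k. x + 1 / real (Suc k)"])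
    show "(\<lambda>k. x + 1 / real (Suc k)) \<longlonglongrightarrow> x"
      using tendsto_add[OF tendsto_const[of x] LIMSEQ_inverse_real_of_nat] by (simp add: inverse_eq_divide)
    show "\<forall>\<^sub>F k in sequentially. q k \<le> x + 1 / real (Suc k)"
      using q(3) by (intro always_eventually allI) (simp add: less_imp_le)
    show "\<forall>\<^sub>F k in sequentially. x \<le> q k" using q(2) by (simp add: less_imp_le)
  qed simp
  then have "filterlim q (at_right x) sequentially"
    using q(2) by (intro tendsto_imp_filterlim_at_right) auto
  then show ?thesis using q by (intro that[of q]) auto
qed

text \<open>A continuous distribution function takes the value \<open>1 - e\<close> at some point \<open>a\<close>, and the set in
  question lies to the right of \<open>a\<close>. This is one half of the fact that a variable with
  continuous distribution function \<open>F\<close> is mapped by \<open>1 - F\<close> to a uniformly distributed one.\<close>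

lemma (in real_distribution) upper_tail_of_cdf:
  assumes cont: "\<And>x. isCont (cdf M) x" and e: "0 < e"
  shows "measure M {x. 1 - cdf M x < e} \<le> e"
proof (cases "e < 1")
  case True
  have "\<exists>a. cdf M a = 1 - e"
  proof -
    obtain b where b: "1 - e < cdf M b"
      using eventually_happens'[OF _ order_tendstoD(1)[OF cdf_lim_at_top_prob, of "1 - e"]] e by auto
    obtain c where c: "cdf M c < 1 - e"
      using eventually_happens'[OF _ order_tendstoD(2)[OF cdf_lim_at_bot, of "1 - e"]] True by auto
    have "c \<le> b" using b c cdf_nondecreasing[of b c] by linarith
    then show ?thesis using IVT[of "cdf M" c "1 - e" b] b c cont by auto
  qed
  then obtain a where a: "cdf M a = 1 - e" by blast
  have "{x. 1 - cdf M x < e} \<subseteq> - {..a}"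
    using cdf_nondecreasing[of _ a] a by fastforce
  then have "measure M {x. 1 - cdf M x < e} \<le> measure M (space M - {..a})"
    by (intro finite_measure_mono) auto
  also have "\<dots> = 1 - cdf M a" by (subst prob_compl) (auto simp: cdf_def)
  finally show ?thesis using a by simp
qed (use prob_le_1[of "{x. 1 - cdf M x < e}"] in linarith)

lemma (in prob_space) nn_integral_indep_var:
  assumes ind: "indep_var A X B Y" and f[measurable]: "f \<in> borel_measurable (A \<Otimes>\<^sub>M B)"
  shows "(\<integral>\<^sup>+\<omega>. f (X \<omega>, Y \<omega>) \<partial>M) = (\<integral>\<^sup>+\<omega>. (\<integral>\<^sup>+\<eta>. f (X \<omega>, Y \<eta>) \<partial>M) \<partial>M)"
proof -
  have [measurable]: "X \<in> measurable M A" "Y \<in> measurable M B"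
    using ind by (auto dest: indep_var_rv1 indep_var_rv2)
  interpret Y: prob_space "distr M B Y" by (rule prob_space_distr) simp
  have "(\<integral>\<^sup>+\<omega>. f (X \<omega>, Y \<omega>) \<partial>M) = (\<integral>\<^sup>+p. f p \<partial>distr M (A \<Otimes>\<^sub>M B) (\<lambda>\<omega>. (X \<omega>, Y \<omega>)))"
    by (simp add: nn_integral_distr)
  also have "\<dots> = (\<integral>\<^sup>+p. f p \<partial>(distr M A X \<Otimes>\<^sub>M distr M B Y))"
    using ind by (simp add: indep_var_distribution_eq)
  also have "\<dots> = (\<integral>\<^sup>+x. \<integral>\<^sup>+y. f (x, y) \<partial>distr M B Y \<partial>distr M A X)"
    by (intro Y.nn_integral_fst[symmetric]) simp
  also have "\<dots> = (\<integral>\<^sup>+\<omega>. (\<integral>\<^sup>+y. f (X \<omega>, y) \<partial>distr M B Y) \<partial>M)"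
    by (rule nn_integral_distr) measurable
  also have "\<dots> = (\<integral>\<^sup>+\<omega>. (\<integral>\<^sup>+\<eta>. f (X \<omega>, Y \<eta>) \<partial>M) \<partial>M)"
    by (intro nn_integral_cong nn_integral_distr) (auto intro: measurable_compose_Pair1 measurable_space)
  finally show ?thesis .
qed

section \<open>Renewal processes and their exponential moments\<close>

locale positive_renewal = prob_space M for M :: "'a measure" +
  fixes \<tau> :: "nat \<Rightarrow> 'a \<Rightarrow> real"
  assumes indep: "indep_vars (\<lambda>_. borel) \<tau> UNIV"
    and ident: "distr M borel (\<tau> i) = distr M borel (\<tau> 0)"
    and pos: "\<omega> \<in> space M \<Longrightarrow> 0 < \<tau> i \<omega>"
begin

abbreviation "S \<equiv> renewal_time \<tau>"
abbreviation "N \<equiv> renewal_count \<tau>"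

text \<open>The first \<open>n\<close> interarrival times as one random vector; it generates the information available
  at the renewal \<open>S n\<close>.\<close>

definition past :: "nat \<Rightarrow> 'a \<Rightarrow> nat \<Rightarrow> real" where
  "past n \<omega> = (\<lambda>i\<in>{..<n}. \<tau> i \<omega>)"

text \<open>The Laplace transform of the interarrival law at one. It is smaller than one since the
  interarrival times are positive, and it governs all estimates on the number of renewals.\<close>

definition \<rho> :: real where "\<rho> = expectation (\<lambda>\<omega>. exp (- \<tau> 0 \<omega>))"

definition F :: "real \<Rightarrow> real" where "F = cdf (distr M borel (\<tau> 0))"

lemma measurable_interarrival[measurable]: "\<tau> i \<in> borel_measurable M"
  using indep by (auto simp: indep_vars_def)

lemma measurable_renewal_time[measurable]: "S n \<in> borel_measurable M"
  by (simp add: renewal_time_def[abs_def])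

lemma measurable_past[measurable]: "past n \<in> measurable M (PiM {..<n} (\<lambda>_. borel))"
  unfolding past_def by measurable

lemma renewal_time_past: "k \<le> n \<Longrightarrow> S k \<omega> = (\<Sum>i<k. past n \<omega> i)"
  by (auto simp: renewal_time_def past_def intro!: sum.cong)

lemma renewal_time_0[simp]: "S 0 \<omega> = 0"
  and renewal_time_Suc: "S (Suc n) \<omega> = S n \<omega> + \<tau> n \<omega>"
  by (auto simp: renewal_time_def)

lemma renewal_time_less_Suc: "\<omega> \<in> space M \<Longrightarrow> S n \<omega> < S (Suc n) \<omega>"
  using pos by (simp add: renewal_time_Suc)

lemma renewal_time_mono: "\<omega> \<in> space M \<Longrightarrow> m \<le> n \<Longrightarrow> S m \<omega> \<le> S n \<omega>"
  by (rule lift_Suc_mono_le[of "\<lambda>n. S n \<omega>"]) (auto intro: less_imp_le renewal_time_less_Suc)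

lemma renewal_time_nonneg: "\<omega> \<in> space M \<Longrightarrow> 0 \<le> S n \<omega>"
  using renewal_time_mono[of \<omega> 0 n] by simp

lemma renewals_upto:
  assumes "\<omega> \<in> space M" "S n \<omega> \<le> t" "t < S (Suc n) \<omega>"
  shows "S k \<omega> \<le> t \<longleftrightarrow> k \<le> n"
  using renewal_time_mono[OF assms(1), of k n] renewal_time_mono[OF assms(1), of "Suc n" k] assms
  by (cases "k \<le> n") auto

lemma renewal_count_eq:
  assumes "\<omega> \<in> space M" "S n \<omega> \<le> t" "t < S (Suc n) \<omega>"
  shows "N t \<omega> = Suc n"
proof -
  have "{k. S k \<omega> \<le> t} = {..n}" using renewals_upto[OF assms] by auto
  then show ?thesis by (simp add: renewal_count_def)
qed

definition no_explosion :: "'a \<Rightarrow> bool" where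
  "no_explosion \<omega> \<longleftrightarrow> \<omega> \<in> space M \<and> (\<forall>t. \<exists>n. t < S n \<omega>)"

lemma current_renewal:
  assumes "no_explosion \<omega>" "0 \<le> t"
  obtains n where "S n \<omega> \<le> t" "t < S (Suc n) \<omega>"
proof -
  define k where "k = (LEAST k. t < S k \<omega>)"
  have k: "t < S k \<omega>" unfolding k_def using assms by (auto simp: no_explosion_def intro: LeastI_ex)
  have least: "\<not> t < S m \<omega>" if "m < k" for m using not_less_Least that unfolding k_def by blast
  have "k \<noteq> 0" using k assms by (intro notI) simp
  then obtain n where "k = Suc n" by (cases k) auto
  then show ?thesis using k least[of n] by (intro that[of n]) auto
qed

lemma renewal_time_le_if_renewal_count:
  assumes "\<omega> \<in> space M" "Suc k \<le> N t \<omega>"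
  shows "S k \<omega> \<le> t"
proof (rule ccontr)
  assume "\<not> S k \<omega> \<le> t"
  then have "{m. S m \<omega> \<le> t} \<subseteq> {..<k}"
    using renewal_time_mono[OF assms(1), of k] by (force simp: not_le[symmetric])
  then have "N t \<omega> \<le> card {..<k}" unfolding renewal_count_def by (intro card_mono) auto
  then show False using assms by simp
qed

lemma renewal_count_ge_iff:
  assumes "no_explosion \<omega>"
  shows "Suc k \<le> N t \<omega> \<longleftrightarrow> S k \<omega> \<le> t"
proof
  have \<omega>: "\<omega> \<in> space M" using assms by (simp add: no_explosion_def)
  show "Suc k \<le> N t \<omega> \<Longrightarrow> S k \<omega> \<le> t" using renewal_time_le_if_renewal_count[OF \<omega>] .
  assume k: "S k \<omega> \<le> t"
  then have "0 \<le> t" using renewal_time_nonneg[OF \<omega>, of k] by linarith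
  then obtain n where n: "S n \<omega> \<le> t" "t < S (Suc n) \<omega>" using current_renewal assms by blast
  show "Suc k \<le> N t \<omega>" using renewal_count_eq[OF \<omega> n] renewals_upto[OF \<omega> n, of k] k by simp
qed

lemma renewal_count_mono:
  assumes "no_explosion \<omega>" "s \<le> t"
  shows "N s \<omega> \<le> N t \<omega>"
proof (cases "N s \<omega>")
  case (Suc k)
  then have "S k \<omega> \<le> s" using renewal_count_ge_iff[OF assms(1), of k s] by simp
  then show ?thesis using renewal_count_ge_iff[OF assms(1), of k t] assms(2) Suc by simp
qed simp

lemma indep_past_future: "indep_var (PiM {..<n} (\<lambda>_. borel)) (past n)
    (PiM {n..<n + m} (\<lambda>_. borel)) (\<lambda>\<omega>. \<lambda>i\<in>{n..<n + m}. \<tau> i \<omega>)"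
  unfolding past_def by (rule indep_var_restrict[OF indep]) auto

lemma nn_integral_past_next:
  assumes [measurable]: "f \<in> borel_measurable (PiM {..<n} (\<lambda>_. borel) \<Otimes>\<^sub>M borel)"
  shows "(\<integral>\<^sup>+\<omega>. f (past n \<omega>, \<tau> n \<omega>) \<partial>M) = (\<integral>\<^sup>+\<omega>. (\<integral>\<^sup>+\<eta>. f (past n \<omega>, \<tau> n \<eta>) \<partial>M) \<partial>M)"
proof -
  have "(\<lambda>(x, y). f (x, y n)) \<in> borel_measurable (PiM {..<n} (\<lambda>_. borel) \<Otimes>\<^sub>M PiM {n..<n + 1} (\<lambda>_. borel))"
    by measurable
  from nn_integral_indep_var[OF indep_past_future this] show ?thesis by simp
qed

lemma nn_integral_ident:
  assumes [measurable]: "f \<in> borel_measurable borel"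
  shows "(\<integral>\<^sup>+\<omega>. f (\<tau> i \<omega>) \<partial>M) = (\<integral>\<^sup>+\<omega>. f (\<tau> 0 \<omega>) \<partial>M)"
proof -
  have "(\<integral>\<^sup>+\<omega>. f (\<tau> j \<omega>) \<partial>M) = (\<integral>\<^sup>+x. f x \<partial>distr M borel (\<tau> 0))" for j
    by (subst ident[of j, symmetric]) (simp add: nn_integral_distr)
  then show ?thesis by metis
qed

lemma emeasure_ident:
  assumes [measurable]: "B \<in> sets borel"
  shows "emeasure M {\<omega> \<in> space M. \<tau> i \<omega> \<in> B} = emeasure (distr M borel (\<tau> 0)) B"
  by (subst ident[of i, symmetric]) (auto simp: emeasure_distr vimage_def Int_def conj_commute)

lemma integrable_exp_interarrival: "integrable M (\<lambda>\<omega>. exp (- \<tau> i \<omega>))"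
  by (rule integrable_const_bound[of _ 1]) (auto intro!: AE_I2 less_imp_le[OF pos])

lemma laplace_nonneg: "0 \<le> \<rho>"
  unfolding \<rho>_def by (rule Bochner_Integration.integral_nonneg) simp

lemma laplace_less_1: "\<rho> < 1"
proof -
  have "expectation (\<lambda>\<omega>. exp (- \<tau> 0 \<omega>)) < expectation (\<lambda>\<omega>. 1)"
    by (rule integral_less_AE_space)
      (auto simp: emeasure_space_1 integrable_exp_interarrival pos)
  then show ?thesis by (simp add: \<rho>_def prob_space)
qed

lemma nn_laplace_prod:
  assumes "finite I"
  shows "(\<integral>\<^sup>+\<omega>. ennreal (exp (- (\<Sum>i\<in>I. \<tau> i \<omega>))) \<partial>M) = ennreal (\<rho> ^ card I)"
proof -
  have ind: "indep_vars (\<lambda>_. borel) (\<lambda>i \<omega>. ennreal (exp (- \<tau> i \<omega>))) I"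
    by (rule indep_vars_compose2[OF indep_vars_subset[OF indep], of I]) auto
  have "(\<integral>\<^sup>+\<omega>. ennreal (exp (- (\<Sum>i\<in>I. \<tau> i \<omega>))) \<partial>M) = (\<integral>\<^sup>+\<omega>. (\<Prod>i\<in>I. ennreal (exp (- \<tau> i \<omega>))) \<partial>M)"
    using assms by (simp add: sum_negf[symmetric] exp_sum prod_ennreal)
  also have "\<dots> = (\<Prod>i\<in>I. \<integral>\<^sup>+\<omega>. ennreal (exp (- \<tau> i \<omega>)) \<partial>M)"
    using assms ind by (rule indep_vars_nn_integral) simp
  also have "\<dots> = (\<Prod>i\<in>I. ennreal \<rho>)"
  proof (rule prod.cong)
    fix i
    have "(\<integral>\<^sup>+\<omega>. ennreal (exp (- \<tau> i \<omega>)) \<partial>M) = (\<integral>\<^sup>+\<omega>. ennreal (exp (- \<tau> 0 \<omega>)) \<partial>M)"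
      by (rule nn_integral_ident[of "\<lambda>x. ennreal (exp (- x))"]) simp
    also have "\<dots> = ennreal \<rho>"
      unfolding \<rho>_def by (intro nn_integral_eq_integral integrable_exp_interarrival) simp
    finally show "(\<integral>\<^sup>+\<omega>. ennreal (exp (- \<tau> i \<omega>)) \<partial>M) = ennreal \<rho>" .
  qed simp
  also have "\<dots> = ennreal (\<rho> ^ card I)" by (simp add: ennreal_power laplace_nonneg)
  finally show ?thesis .
qed

text \<open>Markov's inequality for \<open>exp (- (S (n + m) - S n))\<close>, whose expectation is \<open>\<rho> ^ m\<close>; independence of
  the first \<open>n\<close> interarrival times lets the estimate be localised to an event of the past.\<close>

lemma renewal_after_past_bound:
  assumes [measurable]: "C \<in> sets (PiM {..<n} (\<lambda>_. borel))"
  shows "emeasure M {\<omega> \<in> space M. past n \<omega> \<in> C \<and> S (n + m) \<omega> - S n \<omega> \<le> t}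
    \<le> ennreal (exp t * \<rho> ^ m) * emeasure M {\<omega> \<in> space M. past n \<omega> \<in> C}"
proof -
  let ?Z = "\<lambda>\<omega>. \<lambda>i\<in>{n..<n + m}. \<tau> i \<omega>"
  let ?f = "\<lambda>(x, y). indicator C x * ennreal (exp (- (\<Sum>i\<in>{n..<n + m}. y i)))"
  have incr: "S (n + m) \<omega> - S n \<omega> = (\<Sum>i\<in>{n..<n + m}. \<tau> i \<omega>)" for \<omega>
    by (simp add: renewal_time_def sum_diff_nat_ivl lessThan_atLeast0)
  have "emeasure M {\<omega> \<in> space M. past n \<omega> \<in> C \<and> S (n + m) \<omega> - S n \<omega> \<le> t}
      = (\<integral>\<^sup>+\<omega>. indicator {\<omega> \<in> space M. past n \<omega> \<in> C \<and> S (n + m) \<omega> - S n \<omega> \<le> t} \<omega> \<partial>M)" by simp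
  also have "\<dots> \<le> (\<integral>\<^sup>+\<omega>. ennreal (exp t) * ?f (past n \<omega>, ?Z \<omega>) \<partial>M)"
  proof (rule nn_integral_mono)
    fix \<omega> assume "\<omega> \<in> space M"
    have "1 \<le> ennreal (exp t) * ennreal (exp (- (\<Sum>i\<in>{n..<n + m}. \<tau> i \<omega>)))"
      if "(\<Sum>i\<in>{n..<n + m}. \<tau> i \<omega>) \<le> t"
      using that by (simp add: ennreal_mult[symmetric] exp_add[symmetric])
    then show "indicator {\<omega> \<in> space M. past n \<omega> \<in> C \<and> S (n + m) \<omega> - S n \<omega> \<le> t} \<omega>
        \<le> ennreal (exp t) * ?f (past n \<omega>, ?Z \<omega>)"
      by (auto simp: incr split: split_indicator)
  qed
  also have "\<dots> = ennreal (exp t) * (\<integral>\<^sup>+\<omega>. ?f (past n \<omega>, ?Z \<omega>) \<partial>M)"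
    by (rule nn_integral_cmult) measurable
  also have "(\<integral>\<^sup>+\<omega>. ?f (past n \<omega>, ?Z \<omega>) \<partial>M) = (\<integral>\<^sup>+\<omega>. (\<integral>\<^sup>+\<eta>. ?f (past n \<omega>, ?Z \<eta>) \<partial>M) \<partial>M)"
    by (rule nn_integral_indep_var[OF indep_past_future]) measurable
  also have "\<dots> = (\<integral>\<^sup>+\<omega>. indicator {\<omega> \<in> space M. past n \<omega> \<in> C} \<omega> * ennreal (\<rho> ^ m) \<partial>M)"
    by (intro nn_integral_cong)
      (auto simp: nn_integral_cmult nn_laplace_prod split: split_indicator)
  also have "\<dots> = emeasure M {\<omega> \<in> space M. past n \<omega> \<in> C} * ennreal (\<rho> ^ m)"
    by (simp add: nn_integral_multc)
  finally show ?thesis by (simp add: ennreal_mult mult_ac laplace_nonneg)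
qed

lemma renewal_time_tail:
  "emeasure M {\<omega> \<in> space M. S m \<omega> \<le> t} \<le> ennreal (exp t * \<rho> ^ m)"
proof -
  have "emeasure M {\<omega> \<in> space M. S m \<omega> \<le> t} =
      emeasure M {\<omega> \<in> space M. past 0 \<omega> \<in> space (PiM {..<0} (\<lambda>_. borel)) \<and> S (0 + m) \<omega> - S 0 \<omega> \<le> t}"
    by (intro arg_cong[where f = "emeasure M"]) (use measurable_space[OF measurable_past[of 0]] in auto)
  also have "\<dots> \<le> ennreal (exp t * \<rho> ^ m) * emeasure M {\<omega> \<in> space M. past 0 \<omega> \<in> space (PiM {..<0} (\<lambda>_. borel))}"
    by (rule renewal_after_past_bound) simp
  also have "\<dots> \<le> ennreal (exp t * \<rho> ^ m) * 1"
    by (intro mult_left_mono emeasure_le_1) simp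
  finally show ?thesis by simp
qed

lemma suminf_geometric_bound: "(\<Sum>m. ennreal (exp t * \<rho> ^ m)) = ennreal (exp t / (1 - \<rho>))"
proof (rule suminf_ennreal_eq)
  have "(\<lambda>m. \<rho> ^ m) sums (1 / (1 - \<rho>))"
    using laplace_nonneg laplace_less_1 by (intro geometric_sums) simp
  from sums_mult[OF this, of "exp t"] show "(\<lambda>m. exp t * \<rho> ^ m) sums (exp t / (1 - \<rho>))" by simp
qed (simp add: laplace_nonneg)

text \<open>The tail bound is summable in the number of renewals, so that the Borel--Cantelli lemma applies.\<close>

lemma AE_no_explosion: "AE \<omega> in M. no_explosion \<omega>"
proof -
  have "AE \<omega> in M. eventually (\<lambda>m. \<omega> \<in> space M - {\<omega> \<in> space M. S m \<omega> \<le> real k}) sequentially" for k :: nat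
  proof (rule borel_cantelli_AE1)
    have "(\<Sum>m. emeasure M {\<omega> \<in> space M. S m \<omega> \<le> real k}) \<le> (\<Sum>m. ennreal (exp (real k) * \<rho> ^ m))"
      by (intro suminf_le renewal_time_tail) auto
    then have "(\<Sum>m. emeasure M {\<omega> \<in> space M. S m \<omega> \<le> real k}) < \<infinity>"
      by (simp add: suminf_geometric_bound le_less_trans)
    then show "summable (\<lambda>m. prob {\<omega> \<in> space M. S m \<omega> \<le> real k})"
      by (intro summable_suminf_not_top) (auto simp: emeasure_eq_measure)
  qed (auto simp: less_top[symmetric])
  then have "AE \<omega> in M. \<forall>k. eventually (\<lambda>m. \<omega> \<in> space M - {\<omega> \<in> space M. S m \<omega> \<le> real k}) sequentially"
    by (simp add: AE_all_countable)
  then show ?thesis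
  proof eventually_elim
    case (elim \<omega>)
    have "\<exists>n. t < S n \<omega>" for t
    proof -
      obtain k :: nat where k: "t \<le> real k" using real_arch_simple by blast
      obtain m where "\<omega> \<in> space M - {\<omega> \<in> space M. S m \<omega> \<le> real k}"
        using elim eventually_happens'[OF sequentially_bot] by blast
      then show ?thesis using k by (auto intro: exI[of _ m])
    qed
    moreover have "\<omega> \<in> space M" using elim eventually_happens'[OF sequentially_bot] by blast
    ultimately show ?case by (simp add: no_explosion_def)
  qed
qed

text \<open>Only an inequality, since the counting process is zero where infinitely many renewals occur.\<close>

lemma ennreal_renewal_count_le: 
  assumes "\<omega> \<in> space M"
  shows "ennreal (real (N t \<omega>)) \<le> (\<Sum>m. indicator {\<omega> \<in> space M. S m \<omega> \<le> t} \<omega>)"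
proof (cases "finite {n. S n \<omega> \<le> t}")
  case True
  have "ennreal (real (N t \<omega>)) = (\<Sum>m\<in>{n. S n \<omega> \<le> t}. indicator {\<omega> \<in> space M. S m \<omega> \<le> t} \<omega>)"
  proof -
    have "(\<Sum>m\<in>{n. S n \<omega> \<le> t}. indicator {\<omega> \<in> space M. S m \<omega> \<le> t} \<omega>) = (\<Sum>m\<in>{n. S n \<omega> \<le> t}. 1 :: ennreal)"
      using assms by (intro sum.cong) auto
    then show ?thesis by (simp add: renewal_count_def ennreal_of_nat_eq_real_of_nat)
  qed
  also have "\<dots> = (\<Sum>m. indicator {\<omega> \<in> space M. S m \<omega> \<le> t} \<omega>)"
    using True by (intro suminf_finite[symmetric]) auto
  finally show ?thesis by simp
qed (simp add: renewal_count_def)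

section \<open>The filtration of a renewal process\<close>

abbreviation "P \<equiv> completion M"
abbreviation "\<F> \<equiv> augmented_filtration M (\<lambda>t \<omega>. real (N t \<omega>))"

lemma filtration_generators:
  "{(\<lambda>\<omega>. real (N s \<omega>)) -` B \<inter> space M | s B. 0 \<le> s \<and> s \<le> t \<and> B \<in> sets borel} \<union> null_sets P
    \<subseteq> Pow (space M)"
  using sets.sets_into_space[of _ P] by (auto simp: null_sets_def)

lemma space_filtration[simp]: "space (\<F> t) = space M"
  by (simp add: augmented_filtration_def space_measure_of_conv)

lemma sets_filtration: "sets (\<F> t) = sigma_sets (space M)
   ({(\<lambda>\<omega>. real (N s \<omega>)) -` B \<inter> space M | s B. 0 \<le> s \<and> s \<le> t \<and> B \<in> sets borel} \<union> null_sets P)"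
  unfolding augmented_filtration_def using filtration_generators by (rule sets_measure_of)

lemma null_sets_in_filtration: "A \<in> null_sets P \<Longrightarrow> A \<in> sets (\<F> t)"
  by (simp add: sets_filtration sigma_sets.Basic)

lemma renewal_count_in_filtration:
  "0 \<le> s \<Longrightarrow> s \<le> t \<Longrightarrow> (\<lambda>\<omega>. real (N s \<omega>)) \<in> borel_measurable (\<F> t)"
  by (intro measurableI) (auto simp: sets_filtration intro!: sigma_sets.Basic)

lemma measurable_partial_sum:
  fixes k n :: nat
  shows "k \<le> n \<Longrightarrow> (\<lambda>x. \<Sum>i<k. x i) \<in> borel_measurable (PiM {..<n} (\<lambda>_. borel :: real measure))"
  by (intro borel_measurable_sum measurable_component_singleton) (auto intro: less_le_trans)

text \<open>Between the renewals \<open>n\<close> and \<open>n + 1\<close>, the counting process up to time \<open>t\<close> is a function of the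
  first \<open>n\<close> interarrival times. This holds for the generators of the filtration, and the property
  passes to complements and countable unions.\<close>

lemma filtration_between_renewals:
  assumes "A \<in> sets (\<F> t)"
  shows "\<exists>C\<in>sets (PiM {..<n} (\<lambda>_. borel)). AE \<omega> in P.
    S n \<omega> \<le> t \<longrightarrow> t < S (Suc n) \<omega> \<longrightarrow> (\<omega> \<in> A \<longleftrightarrow> past n \<omega> \<in> C)"
  using assms unfolding sets_filtration
proof (induction rule: sigma_sets.induct)
  case (Basic A)
  then consider s B where "A = (\<lambda>\<omega>. real (N s \<omega>)) -` B \<inter> space M" "0 \<le> s" "s \<le> t" "B \<in> sets borel"
    | "A \<in> null_sets P" by auto
  then show ?case
  proof cases
    case 1
    define c where "c x = (\<Sum>k\<le>n. if (\<Sum>i<k. x i) \<le> s then 1 else 0 :: real)" for x :: "nat \<Rightarrow> real"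
    have [measurable]: "c \<in> borel_measurable (PiM {..<n} (\<lambda>_. borel))"
      unfolding c_def
    proof (rule borel_measurable_sum)
      fix k assume "k \<in> {..n}"
      then have [measurable]: "(\<lambda>x. \<Sum>i<k. x i) \<in> borel_measurable (PiM {..<n} (\<lambda>_. borel :: real measure))"
        by (intro measurable_partial_sum) simp
      show "(\<lambda>x. if (\<Sum>i<k. x i) \<le> s then 1 else 0 :: real) \<in> borel_measurable (PiM {..<n} (\<lambda>_. borel))"
        by measurable
    qed
    have "{x \<in> space (PiM {..<n} (\<lambda>_. borel)). c x \<in> B} \<in> sets (PiM {..<n} (\<lambda>_. borel))"
      using 1 by measurable
    moreover have "\<omega> \<in> A \<longleftrightarrow> past n \<omega> \<in> {x \<in> space (PiM {..<n} (\<lambda>_. borel)). c x \<in> B}"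
      if \<omega>: "\<omega> \<in> space M" and n: "S n \<omega> \<le> t" "t < S (Suc n) \<omega>" for \<omega>
    proof -
      have "{k. S k \<omega> \<le> s} = {k\<in>{..n}. S k \<omega> \<le> s}"
        using renewals_upto[OF \<omega> n] 1 by force
      then have "real (N s \<omega>) = (\<Sum>k\<le>n. if S k \<omega> \<le> s then 1 else 0)"
        by (simp add: renewal_count_def sum.If_cases Int_def)
      also have "\<dots> = c (past n \<omega>)"
        unfolding c_def by (intro sum.cong) (auto simp: renewal_time_past)
      finally show ?thesis using 1 \<omega> measurable_space[OF measurable_past \<omega>] by auto
    qed
    ultimately show ?thesis by (intro bexI AE_I2) auto
  next
    case 2
    then show ?thesis by (intro bexI[of _ "{}"]) (auto dest: AE_not_in)
  qed
next
  case Empty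
  then show ?case by (intro bexI[of _ "{}"]) auto
next
  case (Compl A)
  then obtain C where "C \<in> sets (PiM {..<n} (\<lambda>_. borel))"
    "AE \<omega> in P. S n \<omega> \<le> t \<longrightarrow> t < S (Suc n) \<omega> \<longrightarrow> (\<omega> \<in> A \<longleftrightarrow> past n \<omega> \<in> C)" by blast
  moreover have "AE \<omega> in P. \<omega> \<in> space M \<and> past n \<omega> \<in> space (PiM {..<n} (\<lambda>_. borel))"
    using measurable_space[OF measurable_past] by (intro AE_I2) auto
  ultimately show ?case
    by (intro bexI[of _ "space (PiM {..<n} (\<lambda>_. borel)) - C"]) (auto elim!: eventually_elim2)
next
  case (Union A)
  then have "\<forall>i. \<exists>C. C \<in> sets (PiM {..<n} (\<lambda>_. borel)) \<and>
    (AE \<omega> in P. S n \<omega> \<le> t \<longrightarrow> t < S (Suc n) \<omega> \<longrightarrow> (\<omega> \<in> A i \<longleftrightarrow> past n \<omega> \<in> C))" by blast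
  then obtain C where C: "\<And>i. C i \<in> sets (PiM {..<n} (\<lambda>_. borel))"
    "\<And>i. AE \<omega> in P. S n \<omega> \<le> t \<longrightarrow> t < S (Suc n) \<omega> \<longrightarrow> (\<omega> \<in> A i \<longleftrightarrow> past n \<omega> \<in> C i)"
    unfolding choice_iff by blast
  have "AE \<omega> in P. \<forall>i. S n \<omega> \<le> t \<longrightarrow> t < S (Suc n) \<omega> \<longrightarrow> (\<omega> \<in> A i \<longleftrightarrow> past n \<omega> \<in> C i)"
    unfolding AE_all_countable using C(2) by blast
  then have "AE \<omega> in P. S n \<omega> \<le> t \<longrightarrow> t < S (Suc n) \<omega> \<longrightarrow> (\<omega> \<in> (\<Union>i. A i) \<longleftrightarrow> past n \<omega> \<in> (\<Union>i. C i))"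
    by eventually_elim blast
  then show ?case using C(1) by (intro bexI[of _ "\<Union>i. C i"]) auto
qed

text \<open>The events \<open>S k \<le> u\<close> and \<open>k < N u\<close> differ by a null set of explosions, which the augmentation
  of the filtration contains.\<close>

lemma renewal_event_in_filtration:
  assumes "0 \<le> u" "u \<le> t"
  shows "{\<omega> \<in> space M. S k \<omega> \<le> u} \<in> sets (\<F> t)"
proof -
  have null: "{\<omega> \<in> space M. \<not> no_explosion \<omega>} \<in> null_sets P"
    using AE_completion[OF AE_no_explosion] by (simp add: completion.AE_iff_null_sets)
  let ?A = "{\<omega> \<in> space M. Suc k \<le> N u \<omega>}"
  let ?B = "{\<omega> \<in> space M. S k \<omega> \<le> u} \<inter> {\<omega> \<in> space M. \<not> no_explosion \<omega>}"
  have "(\<lambda>\<omega>. real (N u \<omega>)) -` {real (Suc k)..} \<inter> space (\<F> t) \<in> sets (\<F> t)"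
    by (rule measurable_sets[OF renewal_count_in_filtration]) (use assms in auto)
  also have "(\<lambda>\<omega>. real (N u \<omega>)) -` {real (Suc k)..} \<inter> space (\<F> t) = ?A"
    by (auto simp del: of_nat_Suc)
  finally have "?A \<in> sets (\<F> t)" .
  moreover have "?B \<in> sets (\<F> t)"
    by (rule null_sets_in_filtration, rule null_sets_completion_subset[OF _ null]) auto
  ultimately have "?A \<union> ?B \<in> sets (\<F> t)" by (rule sets.Un)
  also have "?A \<union> ?B = {\<omega> \<in> space M. S k \<omega> \<le> u}"
    using renewal_time_le_if_renewal_count renewal_count_ge_iff by blast
  finally show ?thesis .
qed

lemma renewal_time_in_filtration:
  assumes "0 \<le> s" "s \<le> t" "k \<le> n"
  shows "(\<lambda>\<omega>. if S n \<omega> \<le> s then S k \<omega> else 0) \<in> borel_measurable (\<F> t)"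
  unfolding borel_measurable_iff_le
proof
  fix u
  have 1: "{\<omega> \<in> space M. S n \<omega> \<le> s} \<in> sets (\<F> t)" using assms by (intro renewal_event_in_filtration) auto
  show "{\<omega> \<in> space (\<F> t). (if S n \<omega> \<le> s then S k \<omega> else 0) \<le> u} \<in> sets (\<F> t)"
  proof (cases "0 \<le> u")
    case True
    have "{\<omega> \<in> space M. S k \<omega> \<le> min u s} \<in> sets (\<F> t)"
      using assms True by (intro renewal_event_in_filtration) auto
    then have "(space (\<F> t) - {\<omega> \<in> space M. S n \<omega> \<le> s}) \<union>
        ({\<omega> \<in> space M. S n \<omega> \<le> s} \<inter> {\<omega> \<in> space M. S k \<omega> \<le> min u s}) \<in> sets (\<F> t)"
      using 1 by (intro sets.Un sets.Int sets.Diff sets.top)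
    also have "(space (\<F> t) - {\<omega> \<in> space M. S n \<omega> \<le> s}) \<union>
        ({\<omega> \<in> space M. S n \<omega> \<le> s} \<inter> {\<omega> \<in> space M. S k \<omega> \<le> min u s})
      = {\<omega> \<in> space (\<F> t). (if S n \<omega> \<le> s then S k \<omega> else 0) \<le> u}"
      using True renewal_time_mono[of _ k n] assms(3) by force
    finally show ?thesis .
  next
    case False
    then have "{\<omega> \<in> space (\<F> t). (if S n \<omega> \<le> s then S k \<omega> else 0) \<le> u} = {}"
      using renewal_time_nonneg[of _ k] by (force simp: not_le)
    then show ?thesis by (simp only: sets.empty_sets)
  qed
qed

text \<open>Conversely to \<open>filtration_between_renewals\<close>, the first \<open>n\<close> interarrival times are known at
  time \<open>s\<close> once the renewal \<open>S n\<close> has occurred.\<close>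

lemma past_event_in_filtration:
  assumes C: "C \<in> sets (PiM {..<n} (\<lambda>_. borel))" and st: "0 \<le> s" "s \<le> t"
  shows "{\<omega> \<in> space M. past n \<omega> \<in> C \<and> S n \<omega> \<le> s} \<in> sets (\<F> t)"
proof -
  define G where "G \<omega> = (\<lambda>i\<in>{..<n}. (if S n \<omega> \<le> s then S (Suc i) \<omega> else 0) - (if S n \<omega> \<le> s then S i \<omega> else 0))" for \<omega>
  have "G \<in> measurable (\<F> t) (PiM {..<n} (\<lambda>_. borel))"
    unfolding G_def using st
    by (intro measurable_restrict borel_measurable_diff renewal_time_in_filtration) auto
  then have "G -` C \<inter> space (\<F> t) \<in> sets (\<F> t)" using C by (rule measurable_sets)
  moreover have "{\<omega> \<in> space M. S n \<omega> \<le> s} \<in> sets (\<F> t)" using st by (intro renewal_event_in_filtration) auto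
  moreover have "G \<omega> = past n \<omega>" if "S n \<omega> \<le> s" for \<omega>
    using that by (auto simp: G_def past_def renewal_time_Suc restrict_def)
  then have "{\<omega> \<in> space M. past n \<omega> \<in> C \<and> S n \<omega> \<le> s}
      = (G -` C \<inter> space (\<F> t)) \<inter> {\<omega> \<in> space M. S n \<omega> \<le> s}"
    by auto
  ultimately show ?thesis by simp
qed

text \<open>Conditioning on the past: the next interarrival time is independent of it and has the common law.\<close>

lemma nn_integral_past_next_event:
  assumes [measurable]: "g \<in> borel_measurable (PiM {..<n} (\<lambda>_. borel))"
    "Measurable.pred (PiM {..<n} (\<lambda>_. borel) \<Otimes>\<^sub>M borel) (\<lambda>(x, y). Q x y)"
  shows "(\<integral>\<^sup>+\<omega>. g (past n \<omega>) * indicator {y. Q (past n \<omega>) y} (\<tau> n \<omega>) \<partial>M)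
    = (\<integral>\<^sup>+\<omega>. g (past n \<omega>) * emeasure (distr M borel (\<tau> 0)) {y. Q (past n \<omega>) y} \<partial>M)"
proof -
  let ?f = "\<lambda>(x, y). g x * indicator {p. (\<lambda>(x, y). Q x y) p} (x, y)"
  have f: "?f \<in> borel_measurable (PiM {..<n} (\<lambda>_. borel) \<Otimes>\<^sub>M borel)" by measurable
  have "(\<integral>\<^sup>+\<omega>. g (past n \<omega>) * indicator {y. Q (past n \<omega>) y} (\<tau> n \<omega>) \<partial>M) = (\<integral>\<^sup>+\<omega>. ?f (past n \<omega>, \<tau> n \<omega>) \<partial>M)"
    by (intro nn_integral_cong) (auto split: split_indicator)
  also have "\<dots> = (\<integral>\<^sup>+\<omega>. (\<integral>\<^sup>+\<eta>. ?f (past n \<omega>, \<tau> n \<eta>) \<partial>M) \<partial>M)"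
    by (rule nn_integral_past_next[OF f])
  also have "\<dots> = (\<integral>\<^sup>+\<omega>. g (past n \<omega>) * emeasure (distr M borel (\<tau> 0)) {y. Q (past n \<omega>) y} \<partial>M)"
  proof (rule nn_integral_cong)
    fix \<omega> assume \<omega>: "\<omega> \<in> space M"
    note [measurable] = measurable_space[OF measurable_past \<omega>]
    have Q[measurable]: "{y. Q (past n \<omega>) y} \<in> sets borel"
    proof -
      have "Measurable.pred borel (\<lambda>y. (\<lambda>(x, y). Q x y) (past n \<omega>, y))" by measurable
      then show ?thesis by (simp add: pred_def)
    qed
    have "(\<integral>\<^sup>+\<eta>. ?f (past n \<omega>, \<tau> n \<eta>) \<partial>M) = (\<integral>\<^sup>+\<eta>. g (past n \<omega>) * indicator {y. Q (past n \<omega>) y} (\<tau> n \<eta>) \<partial>M)"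
      by (intro nn_integral_cong) (auto split: split_indicator)
    also have "\<dots> = g (past n \<omega>) * (\<integral>\<^sup>+\<eta>. indicator {y. Q (past n \<omega>) y} (\<tau> n \<eta>) \<partial>M)"
      by (rule nn_integral_cmult) measurable
    also have "(\<integral>\<^sup>+\<eta>. indicator {y. Q (past n \<omega>) y} (\<tau> n \<eta>) \<partial>M)
        = (\<integral>\<^sup>+\<eta>. indicator {\<eta> \<in> space M. \<tau> n \<eta> \<in> {y. Q (past n \<omega>) y}} \<eta> \<partial>M)"
      by (intro nn_integral_cong) (auto split: split_indicator)
    also have "\<dots> = emeasure M {\<eta> \<in> space M. \<tau> n \<eta> \<in> {y. Q (past n \<omega>) y}}"
      by (rule nn_integral_indicator) measurable
    also have "\<dots> = emeasure (distr M borel (\<tau> 0)) {y. Q (past n \<omega>) y}" by (rule emeasure_ident[OF Q])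
    finally show "(\<integral>\<^sup>+\<eta>. ?f (past n \<omega>, \<tau> n \<eta>) \<partial>M) = g (past n \<omega>) * emeasure (distr M borel (\<tau> 0)) {y. Q (past n \<omega>) y}" .
  qed
  finally show ?thesis .
qed

text \<open>A renewal in \<open>(s, t]\<close> requires that the next one, \<open>S (Suc n)\<close>, falls in this interval. Given that,
  the further renewals up to \<open>t\<close> are renewals of a fresh process within a time of at most one, and
  their expected number is bounded by the geometric series in \<open>\<rho>\<close>. The restriction to
  \<open>t \<le> s + 1\<close> keeps the constant independent of \<open>t\<close>.\<close>

lemma expected_new_renewals_le:
  assumes C[measurable]: "C \<in> sets (PiM {..<n} (\<lambda>_. borel))" and st: "0 \<le> s" "s \<le> t" "t \<le> s + 1"
  shows "(\<integral>\<^sup>+\<omega>. ennreal (real (N t \<omega>) - real (N s \<omega>)) *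
      indicator {\<omega> \<in> space M. past n \<omega> \<in> C \<and> S n \<omega> \<le> s \<and> s < S (Suc n) \<omega>} \<omega> \<partial>P)
    \<le> ennreal (exp 1 / (1 - \<rho>)) * emeasure M {\<omega> \<in> space M. past n \<omega> \<in> C \<and> S n \<omega> \<le> s \<and> s < S (Suc n) \<omega> \<and> S (Suc n) \<omega> \<le> t}"
proof -
  let ?A = "{\<omega> \<in> space M. past n \<omega> \<in> C \<and> S n \<omega> \<le> s \<and> s < S (Suc n) \<omega>}"
  let ?B = "{\<omega> \<in> space M. past n \<omega> \<in> C \<and> S n \<omega> \<le> s \<and> s < S (Suc n) \<omega> \<and> S (Suc n) \<omega> \<le> t}"
  define D where "D = {x \<in> space (PiM {..<Suc n} (\<lambda>_. borel :: real measure)).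
    restrict x {..<n} \<in> C \<and> (\<Sum>i<n. x i) \<le> s \<and> s < (\<Sum>i<Suc n. x i) \<and> (\<Sum>i<Suc n. x i) \<le> t}"
  have [measurable]: "(\<lambda>x. restrict x {..<n}) \<in> measurable (PiM {..<Suc n} (\<lambda>_. borel :: real measure)) (PiM {..<n} (\<lambda>_. borel))"
    by (rule measurable_restrict_subset) auto
  note [measurable] = measurable_partial_sum[of n "Suc n"] measurable_partial_sum[of "Suc n" "Suc n"]
  have D[measurable]: "D \<in> sets (PiM {..<Suc n} (\<lambda>_. borel))" unfolding D_def by (measurable; simp)
  have restr: "restrict (past (Suc n) \<omega>) {..<n} = past n \<omega>" for \<omega>
    by (auto simp: past_def fun_eq_iff)
  have past_D: "{\<omega> \<in> space M. past (Suc n) \<omega> \<in> D} = ?B"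
    using measurable_space[OF measurable_past[of "Suc n"]] renewal_time_past[of n "Suc n"] renewal_time_past[of "Suc n" "Suc n"]
    by (auto simp: D_def restr)
  define E where "E m = {\<omega> \<in> space M. past (Suc n) \<omega> \<in> D \<and> S (Suc n + m) \<omega> - S (Suc n) \<omega> \<le> 1}" for m
  have E[measurable]: "E m \<in> sets M" for m unfolding E_def by measurable
  have "AE \<omega> in P. ennreal (real (N t \<omega>) - real (N s \<omega>)) * indicator ?A \<omega> \<le> (\<Sum>m. indicator (E m) \<omega>)"
    using AE_completion[OF AE_no_explosion]
  proof eventually_elim
    case (elim \<omega>)
    have \<omega>: "\<omega> \<in> space M" using elim by (simp add: no_explosion_def)
    show ?case
    proof (cases "\<omega> \<in> ?A")
      case True
      have "0 \<le> t" using st by simp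
      then obtain k where k: "S k \<omega> \<le> t" "t < S (Suc k) \<omega>" using current_renewal elim by blast
      have "n \<le> k" using renewals_upto[OF \<omega> k, of n] True st by auto
      have Ns: "N s \<omega> = Suc n" using True by (intro renewal_count_eq) auto
      have inE: "\<omega> \<in> E m" if "m < k - n" for m
      proof -
        have "S (Suc n + m) \<omega> \<le> t" "S (Suc n) \<omega> \<le> t" using renewals_upto[OF \<omega> k] that by auto
        then show ?thesis
          using True \<omega> past_D st unfolding E_def by auto
      qed
      have "real (N t \<omega>) - real (N s \<omega>) = real (k - n)"
        using \<open>n \<le> k\<close> renewal_count_eq[OF \<omega> k] Ns by (simp add: of_nat_diff)
      then have "ennreal (real (N t \<omega>) - real (N s \<omega>)) = (\<Sum>m<k - n. 1)"
        by (simp add: ennreal_of_nat_eq_real_of_nat)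
      also have "\<dots> = (\<Sum>m<k - n. indicator (E m) \<omega>)" using inE by (intro sum.cong) auto
      also have "\<dots> \<le> (\<Sum>m. indicator (E m) \<omega>)" by (intro sum_le_suminf) auto
      finally show ?thesis using True by simp
    qed simp
  qed
  then have "(\<integral>\<^sup>+\<omega>. ennreal (real (N t \<omega>) - real (N s \<omega>)) * indicator ?A \<omega> \<partial>P) \<le> (\<integral>\<^sup>+\<omega>. (\<Sum>m. indicator (E m) \<omega>) \<partial>P)"
    by (rule nn_integral_mono_AE)
  also have "\<dots> = (\<Sum>m. emeasure M (E m))"
    by (simp add: nn_integral_completion nn_integral_suminf)
  also have "\<dots> \<le> (\<Sum>m. ennreal (exp 1 * \<rho> ^ m) * emeasure M {\<omega> \<in> space M. past (Suc n) \<omega> \<in> D})"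
    unfolding E_def by (intro suminf_le renewal_after_past_bound D) auto
  also have "\<dots> = ennreal (exp 1 / (1 - \<rho>)) * emeasure M ?B"
    by (simp add: ennreal_suminf_multc suminf_geometric_bound past_D)
  finally show ?thesis .
qed

end

section \<open>Increments of the compensator between renewals\<close>

text \<open>The density of the interarrival law enters as continuity of the distribution function.\<close>

locale renewal_compensator = positive_renewal M \<tau> for M :: "'a measure" and \<tau> +
  fixes \<Lambda> :: "real \<Rightarrow> 'a \<Rightarrow> real"
  assumes compensator: "is_compensator P \<F> (\<lambda>t \<omega>. real (N t \<omega>)) \<Lambda>"
    and continuous_law: "isCont F x"
begin

sublocale law: real_distribution "distr M borel (\<tau> 0)" by (rule real_distribution_distr) simp
sublocale completed: prob_space P by (rule prob_space_completion)

lemma mono_F: "mono F" and F_le_1: "F x \<le> 1"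
  unfolding F_def using law.cdf_nondecreasing law.cdf_bounded_prob by (auto intro: monoI)

lemma F_nonneg: "0 \<le> F x" unfolding F_def by (rule law.cdf_nonneg)

lemma measurable_F[measurable]: "F \<in> borel_measurable borel"
  using continuous_law by (intro borel_measurable_continuous_onI continuous_at_imp_continuous_on) auto

lemma subalgebra_filtration: "0 \<le> t \<Longrightarrow> subalgebra P (\<F> t)"
  and filtration_measurable_difference: "0 \<le> t \<Longrightarrow> (\<lambda>\<omega>. real (N t \<omega>) - \<Lambda> t \<omega>) \<in> borel_measurable (\<F> t)"
  and integrable_difference: "0 \<le> t \<Longrightarrow> integrable P (\<lambda>\<omega>. real (N t \<omega>) - \<Lambda> t \<omega>)"
  and martingale: "0 \<le> s \<Longrightarrow> s \<le> t \<Longrightarrow>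
    AE \<omega> in P. real_cond_exp P (\<F> s) (\<lambda>\<omega>. real (N t \<omega>) - \<Lambda> t \<omega>) \<omega> = real (N s \<omega>) - \<Lambda> s \<omega>"
  using compensator unfolding is_compensator_def is_martingale_def by blast+

lemma measurable_compensator_filtration: "0 \<le> t \<Longrightarrow> \<Lambda> t \<in> borel_measurable (\<F> t)"
  using borel_measurable_diff[OF renewal_count_in_filtration filtration_measurable_difference, of t t] by simp

lemma measurable_renewal_count: "0 \<le> t \<Longrightarrow> (\<lambda>\<omega>. real (N t \<omega>)) \<in> borel_measurable P"
  by (rule measurable_from_subalg[OF subalgebra_filtration renewal_count_in_filtration]) auto

lemma integrable_renewal_count:
  assumes "0 \<le> t" shows "integrable P (\<lambda>\<omega>. real (N t \<omega>))"
proof (rule integrableI_bounded)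
  have "(\<integral>\<^sup>+\<omega>. ennreal (norm (real (N t \<omega>))) \<partial>P) \<le> (\<integral>\<^sup>+\<omega>. (\<Sum>m. indicator {\<omega> \<in> space M. S m \<omega> \<le> t} \<omega>) \<partial>P)"
    using ennreal_renewal_count_le by (intro nn_integral_mono) auto
  also have "\<dots> = (\<Sum>m. emeasure M {\<omega> \<in> space M. S m \<omega> \<le> t})"
    by (simp add: nn_integral_completion nn_integral_suminf)
  also have "\<dots> \<le> (\<Sum>m. ennreal (exp t * \<rho> ^ m))" by (intro suminf_le renewal_time_tail) auto
  finally show "(\<integral>\<^sup>+\<omega>. ennreal (norm (real (N t \<omega>))) \<partial>P) < \<infinity>"
    by (simp add: suminf_geometric_bound le_less_trans)
qed (rule measurable_renewal_count[OF assms])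

lemma integrable_compensator: "0 \<le> t \<Longrightarrow> integrable P (\<Lambda> t)"
  using Bochner_Integration.integrable_diff[OF integrable_renewal_count integrable_difference, of t t] by simp

lemma AE_compensator_path: "AE \<omega> in P. \<Lambda> 0 \<omega> = 0 \<and> mono_on {0..} (\<lambda>t. \<Lambda> t \<omega>) \<and>
        (\<forall>t\<ge>0. ((\<lambda>u. \<Lambda> u \<omega>) \<longlongrightarrow> \<Lambda> t \<omega>) (at_right t))"
  using compensator by (simp add: is_compensator_def)

lemma set_integral_increments:
  assumes st: "0 \<le> s" "s \<le> t" and A: "A \<in> sets (\<F> s)"
  shows "(LINT \<omega>:A|P. \<Lambda> t \<omega> - \<Lambda> s \<omega>) = (LINT \<omega>:A|P. real (N t \<omega>) - real (N s \<omega>))"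
proof -
  interpret sigma_finite_subalgebra P "\<F> s"
    by (intro finite_measure_subalgebra_is_sigma_finite finite_measure_subalgebra.intro
        completed.finite_measure_axioms finite_measure_subalgebra_axioms.intro subalgebra_filtration st)
  have AP: "A \<in> sets P" using A subalgebra_filtration[OF st(1)] by (auto simp: subalgebra_def)
  have t: "0 \<le> t" using st by simp
  have int: "set_integrable P A (\<lambda>\<omega>. real (N u \<omega>))" "set_integrable P A (\<Lambda> u)" if "0 \<le> u" for u
    unfolding set_integrable_def
    using that AP by (auto intro!: integrable_mult_indicator integrable_renewal_count integrable_compensator
        simp del: real_scaleR_def)
  have "(LINT \<omega>:A|P. real (N t \<omega>) - \<Lambda> t \<omega>) = (LINT \<omega>:A|P. real_cond_exp P (\<F> s) (\<lambda>\<omega>. real (N t \<omega>) - \<Lambda> t \<omega>) \<omega>)"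
    by (rule real_cond_exp_intA[OF integrable_difference[OF t] A])
  also have "\<dots> = (LINT \<omega>:A|P. real (N s \<omega>) - \<Lambda> s \<omega>)"
    using martingale[OF st] AP integrable_difference[OF st(1)]
    by (intro set_lebesgue_integral_cong_AE) (auto intro: borel_measurable_cond_exp2)
  finally show ?thesis using int st t by simp
qed

text \<open>Let \<open>D\<close> be the event that the inequality fails while the factor \<open>1 - F (t - S n)\<close> is positive.
  It agrees, up to a null set, with an event \<open>A\<close> known at time \<open>s\<close>, intersected with the event that
  the next renewal comes after \<open>t\<close>. By the martingale property on \<open>A\<close>, the integral of
  \<open>\<Lambda> t - \<Lambda> s\<close> over \<open>D\<close> is at most that of \<open>q = K * (F (t - S n) - F (s - S n)) / (1 - F (t - S n))\<close>, with \<open>K\<close> the constant of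
  the statement. But \<open>\<Lambda> t - \<Lambda> s\<close> exceeds
  \<open>q\<close> on \<open>D\<close>, so \<open>D\<close> is a null set.\<close>

lemma compensator_increment_bound:
  assumes s: "0 \<le> s" "s < t" "t \<le> s + 1"
  shows "AE \<omega> in P. S n \<omega> \<le> s \<longrightarrow> t < S (Suc n) \<omega> \<longrightarrow>
    (\<Lambda> t \<omega> - \<Lambda> s \<omega>) * (1 - F (t - S n \<omega>)) \<le> exp 1 / (1 - \<rho>) * (F (t - S n \<omega>) - F (s - S n \<omega>))"
proof -
  define K where "K = exp 1 / (1 - \<rho>)"
  have K: "K \<ge> 0" using laplace_less_1 by (simp add: K_def)
  have t: "0 \<le> t" using s by simp
  \<comment> \<open>Only on \<open>S n \<le> s\<close> is the renewal time known at time \<open>s\<close>.\<close>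
  define Y where "Y \<omega> = (if S n \<omega> \<le> s then S n \<omega> else 0)" for \<omega>
  define D where "D = {\<omega> \<in> space M. S n \<omega> \<le> s \<and> t < S (Suc n) \<omega> \<and> F (t - S n \<omega>) < 1 \<and>
    K * (F (t - S n \<omega>) - F (s - S n \<omega>)) < (\<Lambda> t \<omega> - \<Lambda> s \<omega>) * (1 - F (t - S n \<omega>))}"
  have D_filt: "D \<in> sets (\<F> t)"
  proof -
    have [measurable]: "Y \<in> borel_measurable (\<F> t)"
      unfolding Y_def using s by (intro renewal_time_in_filtration) auto
    have [measurable]: "\<Lambda> t \<in> borel_measurable (\<F> t)" by (rule measurable_compensator_filtration[OF t])
    have "sets (\<F> s) \<subseteq> sets (\<F> t)"
      unfolding sets_filtration using s by (intro sigma_sets_mono') (auto; blast intro: order_trans less_imp_le)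
    then have [measurable]: "\<Lambda> s \<in> borel_measurable (\<F> t)"
      by (intro measurable_from_subalg[OF _ measurable_compensator_filtration[OF s(1)]]) (simp add: subalgebra_def)
    have "{\<omega> \<in> space (\<F> t). F (t - Y \<omega>) < 1 \<and>
        K * (F (t - Y \<omega>) - F (s - Y \<omega>)) < (\<Lambda> t \<omega> - \<Lambda> s \<omega>) * (1 - F (t - Y \<omega>))} \<in> sets (\<F> t)"
      by measurable
    moreover have "{\<omega> \<in> space M. S n \<omega> \<le> s} \<in> sets (\<F> t)" "{\<omega> \<in> space M. S (Suc n) \<omega> \<le> t} \<in> sets (\<F> t)"
      using s t by (auto intro!: renewal_event_in_filtration)
    ultimately have "{\<omega> \<in> space M. S n \<omega> \<le> s} \<inter> (space (\<F> t) - {\<omega> \<in> space M. S (Suc n) \<omega> \<le> t}) \<inter>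
      {\<omega> \<in> space (\<F> t). F (t - Y \<omega>) < 1 \<and>
        K * (F (t - Y \<omega>) - F (s - Y \<omega>)) < (\<Lambda> t \<omega> - \<Lambda> s \<omega>) * (1 - F (t - Y \<omega>))} \<in> sets (\<F> t)"
      by (intro sets.Int sets.Diff sets.top)
    also have "{\<omega> \<in> space M. S n \<omega> \<le> s} \<inter> (space (\<F> t) - {\<omega> \<in> space M. S (Suc n) \<omega> \<le> t}) \<inter>
      {\<omega> \<in> space (\<F> t). F (t - Y \<omega>) < 1 \<and>
        K * (F (t - Y \<omega>) - F (s - Y \<omega>)) < (\<Lambda> t \<omega> - \<Lambda> s \<omega>) * (1 - F (t - Y \<omega>))} = D"
      by (auto simp: D_def Y_def)
    finally show ?thesis .
  qed
  have D_P[measurable]: "D \<in> sets P" using D_filt subalgebra_filtration[OF t] by (auto simp: subalgebra_def)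
  obtain C0 where C0[measurable]: "C0 \<in> sets (PiM {..<n} (\<lambda>_. borel))"
    and C0_D: "AE \<omega> in P. S n \<omega> \<le> t \<longrightarrow> t < S (Suc n) \<omega> \<longrightarrow> (\<omega> \<in> D \<longleftrightarrow> past n \<omega> \<in> C0)"
    using filtration_between_renewals[OF D_filt] by blast
  note [measurable] = measurable_partial_sum[OF order_refl]
  \<comment> \<open>Where \<open>F (t - S n) = 1\<close> the quotient \<open>q\<close> below would be a division by zero; no path in \<open>D\<close> is lost.\<close>
  define C where "C = {x \<in> space (PiM {..<n} (\<lambda>_. borel)). x \<in> C0 \<and> (\<Sum>i<n. x i) \<le> s \<and> F (t - (\<Sum>i<n. x i)) < 1}"
  have C[measurable]: "C \<in> sets (PiM {..<n} (\<lambda>_. borel))" unfolding C_def by measurable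
  have past_C: "past n \<omega> \<in> C \<longleftrightarrow> past n \<omega> \<in> C0 \<and> S n \<omega> \<le> s \<and> F (t - S n \<omega>) < 1" if "\<omega> \<in> space M" for \<omega>
    using measurable_space[OF measurable_past that] by (simp add: C_def renewal_time_past[OF order_refl])
  define A where "A = {\<omega> \<in> space M. past n \<omega> \<in> C \<and> S n \<omega> \<le> s \<and> s < S (Suc n) \<omega>}"
  have A_filt: "A \<in> sets (\<F> s)"
  proof -
    have "{\<omega> \<in> space M. past n \<omega> \<in> C \<and> S n \<omega> \<le> s} \<inter> (space (\<F> s) - {\<omega> \<in> space M. S (Suc n) \<omega> \<le> s}) \<in> sets (\<F> s)"
      using s by (intro sets.Int sets.Diff sets.top renewal_event_in_filtration past_event_in_filtration C) auto
    also have "{\<omega> \<in> space M. past n \<omega> \<in> C \<and> S n \<omega> \<le> s} \<inter> (space (\<F> s) - {\<omega> \<in> space M. S (Suc n) \<omega> \<le> s}) = A"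
      by (auto simp: A_def)
    finally show ?thesis .
  qed
  have A_P[measurable]: "A \<in> sets P" using A_filt subalgebra_filtration[OF s(1)] by (auto simp: subalgebra_def)
  have D_iff: "AE \<omega> in P. \<omega> \<in> D \<longleftrightarrow> \<omega> \<in> A \<and> t < S (Suc n) \<omega>"
    using C0_D
  proof (rule AE_mp, intro AE_I2 impI)
    fix \<omega> assume "\<omega> \<in> space P" and *: "S n \<omega> \<le> t \<longrightarrow> t < S (Suc n) \<omega> \<longrightarrow> (\<omega> \<in> D \<longleftrightarrow> past n \<omega> \<in> C0)"
    then have \<omega>: "\<omega> \<in> space M" by simp
    show "\<omega> \<in> D \<longleftrightarrow> \<omega> \<in> A \<and> t < S (Suc n) \<omega>"
    proof
      assume D: "\<omega> \<in> D"
      then have "S n \<omega> \<le> s" "t < S (Suc n) \<omega>" "F (t - S n \<omega>) < 1" by (auto simp: D_def)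
      then show "\<omega> \<in> A \<and> t < S (Suc n) \<omega>" using * D s \<omega> by (auto simp: A_def past_C)
    next
      assume "\<omega> \<in> A \<and> t < S (Suc n) \<omega>"
      then show "\<omega> \<in> D" using * s by (auto simp: A_def past_C)
    qed
  qed
  define q where "q x = K * (F (t - x) - F (s - x)) / (1 - F (t - x))" for x
  have [measurable]: "q \<in> borel_measurable borel" unfolding q_def by measurable
  have F_st: "F (s - x) \<le> F (t - x)" for x using s by (intro monoD[OF mono_F]) simp
  have q: "0 \<le> q x" for x using K F_st F_le_1 by (simp add: q_def)
  let ?J = "\<integral>\<^sup>+\<omega>. ennreal (q (S n \<omega>)) * indicator D \<omega> \<partial>P"
  \<comment> \<open>Both sides are the integral over \<open>C\<close> of \<open>K * (F (t - S n) - F (s - S n))\<close>: on the left by averaging the next interarrival time over \<open>(s - S n, t - S n]\<close>, on the right over \<open>(t - S n, \<infinity>)\<close>.\<close>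
  have J: "ennreal K * emeasure M {\<omega> \<in> space M. past n \<omega> \<in> C \<and> S n \<omega> \<le> s \<and> s < S (Suc n) \<omega> \<and> S (Suc n) \<omega> \<le> t} = ?J"
  proof -
    let ?law = "distr M borel (\<tau> 0)"
    let ?\<sigma> = "\<lambda>x. \<Sum>i<n. x i"
    have Ioc: "emeasure ?law {y. s < \<sigma> + y \<and> \<sigma> + y \<le> t} = ennreal (F (t - \<sigma>) - F (s - \<sigma>))" for \<sigma>
    proof -
      have "{y. s < \<sigma> + y \<and> \<sigma> + y \<le> t} = {s - \<sigma><..t - \<sigma>}" by auto
      then show ?thesis using s by (simp add: law.emeasure_Ioc F_def)
    qed
    have Ioi: "emeasure ?law {y. t < \<sigma> + y} = ennreal (1 - F (t - \<sigma>))" for \<sigma>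
    proof -
      have "{y. t < \<sigma> + y} = space ?law - {..t - \<sigma>}" by auto
      moreover have "law.prob (space ?law - {..t - \<sigma>}) = 1 - F (t - \<sigma>)"
        unfolding F_def cdf_def by (rule law.prob_compl) simp
      ultimately show ?thesis by (simp only: law.emeasure_eq_measure)
    qed
    have "ennreal K * emeasure M {\<omega> \<in> space M. past n \<omega> \<in> C \<and> S n \<omega> \<le> s \<and> s < S (Suc n) \<omega> \<and> S (Suc n) \<omega> \<le> t}
      = (\<integral>\<^sup>+\<omega>. ennreal K * indicator {\<omega> \<in> space M. past n \<omega> \<in> C \<and> S n \<omega> \<le> s \<and> s < S (Suc n) \<omega> \<and> S (Suc n) \<omega> \<le> t} \<omega> \<partial>M)"
      by (rule nn_integral_cmult_indicator[symmetric]) measurable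
    also have "\<dots> = (\<integral>\<^sup>+\<omega>. (\<lambda>x. ennreal K * indicator C x) (past n \<omega>) *
        indicator {y. s < ?\<sigma> (past n \<omega>) + y \<and> ?\<sigma> (past n \<omega>) + y \<le> t} (\<tau> n \<omega>) \<partial>M)"
      by (intro nn_integral_cong)
        (auto simp: renewal_time_Suc renewal_time_past[OF order_refl, symmetric] past_C split: split_indicator)
    also have "\<dots> = (\<integral>\<^sup>+\<omega>. (\<lambda>x. ennreal K * indicator C x) (past n \<omega>) *
        emeasure ?law {y. s < ?\<sigma> (past n \<omega>) + y \<and> ?\<sigma> (past n \<omega>) + y \<le> t} \<partial>M)"
      by (rule nn_integral_past_next_event) measurable
    also have "\<dots> = (\<integral>\<^sup>+\<omega>. (\<lambda>x. ennreal (q (?\<sigma> x)) * indicator C x) (past n \<omega>) *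
        emeasure ?law {y. t < ?\<sigma> (past n \<omega>) + y} \<partial>M)"
    proof (intro nn_integral_cong)
      fix \<omega> assume \<omega>: "\<omega> \<in> space M"
      have "ennreal K * ennreal (F (t - S n \<omega>) - F (s - S n \<omega>)) = ennreal (q (S n \<omega>)) * ennreal (1 - F (t - S n \<omega>))"
        if "F (t - S n \<omega>) < 1"
        using that K F_st q by (subst (1 2) ennreal_mult[symmetric]) (auto simp: q_def)
      then show "(\<lambda>x. ennreal K * indicator C x) (past n \<omega>) * emeasure ?law {y. s < ?\<sigma> (past n \<omega>) + y \<and> ?\<sigma> (past n \<omega>) + y \<le> t}
          = (\<lambda>x. ennreal (q (?\<sigma> x)) * indicator C x) (past n \<omega>) * emeasure ?law {y. t < ?\<sigma> (past n \<omega>) + y}"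
        unfolding Ioc Ioi using past_C[OF \<omega>] 
        by (auto simp: renewal_time_past[OF order_refl, symmetric] split: split_indicator)
    qed
    also have "\<dots> = (\<integral>\<^sup>+\<omega>. (\<lambda>x. ennreal (q (?\<sigma> x)) * indicator C x) (past n \<omega>) *
        indicator {y. t < ?\<sigma> (past n \<omega>) + y} (\<tau> n \<omega>) \<partial>M)"
      by (rule nn_integral_past_next_event[symmetric]) measurable
    also have "\<dots> = (\<integral>\<^sup>+\<omega>. (\<lambda>x. ennreal (q (?\<sigma> x)) * indicator C x) (past n \<omega>) *
        indicator {y. t < ?\<sigma> (past n \<omega>) + y} (\<tau> n \<omega>) \<partial>P)"
      by (simp add: nn_integral_completion)
    also have "\<dots> = ?J"
    proof (rule nn_integral_cong_AE, rule AE_mp[OF D_iff], intro AE_I2 impI)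
      fix \<omega> assume "\<omega> \<in> space P" and *: "\<omega> \<in> D \<longleftrightarrow> \<omega> \<in> A \<and> t < S (Suc n) \<omega>"
      then have \<omega>: "\<omega> \<in> space M" by simp
      show "(\<lambda>x. ennreal (q (?\<sigma> x)) * indicator C x) (past n \<omega>) * indicator {y. t < ?\<sigma> (past n \<omega>) + y} (\<tau> n \<omega>)
          = ennreal (q (S n \<omega>)) * indicator D \<omega>"
        using * \<omega> s by (auto simp: renewal_time_past[OF order_refl, symmetric] renewal_time_Suc past_C A_def split: split_indicator)
    qed
    finally show ?thesis .
  qed
  have J_fin: "?J < \<infinity>" unfolding J[symmetric] by (simp add: ennreal_mult_less_top emeasure_eq_measure)
  have meas_P: "S n \<in> borel_measurable P" "\<Lambda> t \<in> borel_measurable P" "\<Lambda> s \<in> borel_measurable P"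
    using integrable_compensator s t by (auto intro: measurable_completion)
  note [measurable] = meas_P
  have "(\<integral>\<^sup>+\<omega>. ennreal (\<Lambda> t \<omega> - \<Lambda> s \<omega>) * indicator D \<omega> \<partial>P) \<le> (\<integral>\<^sup>+\<omega>. ennreal (\<Lambda> t \<omega> - \<Lambda> s \<omega>) * indicator A \<omega> \<partial>P)"
    using D_iff by (intro nn_integral_mono_AE) (auto elim!: eventually_mono split: split_indicator)
  also have "\<dots> = ennreal (LINT \<omega>:A|P. \<Lambda> t \<omega> - \<Lambda> s \<omega>)"
  proof -
    have "AE \<omega> in P. \<Lambda> s \<omega> \<le> \<Lambda> t \<omega>" using AE_compensator_path
      by eventually_elim (use s t in \<open>auto dest!: mono_onD[of _ _ s t]\<close>)
    then have "(\<integral>\<^sup>+\<omega>. ennreal (indicator A \<omega> *\<^sub>R (\<Lambda> t \<omega> - \<Lambda> s \<omega>)) \<partial>P) = ennreal (LINT \<omega>:A|P. \<Lambda> t \<omega> - \<Lambda> s \<omega>)"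
      unfolding set_lebesgue_integral_def using integrable_compensator s t
      by (intro nn_integral_eq_integral integrable_mult_indicator Bochner_Integration.integrable_diff A_P)
        (auto elim!: eventually_mono split: split_indicator)
    then show ?thesis by (simp add: indicator_mult_ennreal mult.commute)
  qed
  also have "\<dots> = ennreal (LINT \<omega>:A|P. real (N t \<omega>) - real (N s \<omega>))"
    using set_integral_increments[OF s(1) _ A_filt] s by simp
  also have "\<dots> = (\<integral>\<^sup>+\<omega>. ennreal (real (N t \<omega>) - real (N s \<omega>)) * indicator A \<omega> \<partial>P)"
  proof -
    have "AE \<omega> in P. N s \<omega> \<le> N t \<omega>" using AE_completion[OF AE_no_explosion]
      by eventually_elim (use s in \<open>auto intro: renewal_count_mono\<close>)
    then have "(\<integral>\<^sup>+\<omega>. ennreal (indicator A \<omega> *\<^sub>R (real (N t \<omega>) - real (N s \<omega>))) \<partial>P) = ennreal (LINT \<omega>:A|P. real (N t \<omega>) - real (N s \<omega>))"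
      unfolding set_lebesgue_integral_def using integrable_renewal_count s t
      by (intro nn_integral_eq_integral integrable_mult_indicator Bochner_Integration.integrable_diff A_P)
        (auto elim!: eventually_mono split: split_indicator)
    then show ?thesis by (simp add: indicator_mult_ennreal mult.commute)
  qed
  also have "\<dots> \<le> ?J"
    unfolding J[symmetric] A_def K_def using s by (intro expected_new_renewals_le C) auto
  finally have le: "(\<integral>\<^sup>+\<omega>. ennreal (\<Lambda> t \<omega> - \<Lambda> s \<omega>) * indicator D \<omega> \<partial>P) \<le> ?J" .
  have less: "q (S n \<omega>) < \<Lambda> t \<omega> - \<Lambda> s \<omega>" if "\<omega> \<in> D" for \<omega>
    using that by (auto simp: D_def q_def divide_less_eq)
  have "(\<integral>\<^sup>+\<omega>. ennreal (\<Lambda> t \<omega> - \<Lambda> s \<omega>) * indicator D \<omega> - ennreal (q (S n \<omega>)) * indicator D \<omega> \<partial>P)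
      = (\<integral>\<^sup>+\<omega>. ennreal (\<Lambda> t \<omega> - \<Lambda> s \<omega>) * indicator D \<omega> \<partial>P) - ?J"
    using less J_fin by (intro nn_integral_diff) (auto intro!: AE_I2 ennreal_leI less_imp_le[OF less] split: split_indicator)
  also have "\<dots> = 0" using le le_less_trans[OF le J_fin] by (intro diff_eq_0_ennreal) auto
  finally have "AE \<omega> in P. ennreal (\<Lambda> t \<omega> - \<Lambda> s \<omega>) * indicator D \<omega> - ennreal (q (S n \<omega>)) * indicator D \<omega> = 0"
    by (subst (asm) nn_integral_0_iff_AE) measurable
  then have "AE \<omega> in P. \<omega> \<notin> D"
  proof eventually_elim
    case (elim \<omega>)
    show ?case
    proof
      assume D: "\<omega> \<in> D"
      then have "ennreal (\<Lambda> t \<omega> - \<Lambda> s \<omega>) - ennreal (q (S n \<omega>)) = 0" using elim by simp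
      then have "ennreal (\<Lambda> t \<omega> - \<Lambda> s \<omega> - q (S n \<omega>)) = 0" by (subst (asm) ennreal_minus) (rule q)
      then show False using less[OF D] by (subst (asm) ennreal_eq_0_iff) simp
    qed
  qed
  then show ?thesis unfolding K_def[symmetric]
  proof (rule AE_mp, intro AE_I2 impI)
    fix \<omega> assume "\<omega> \<in> space P" "\<omega> \<notin> D" "S n \<omega> \<le> s" "t < S (Suc n) \<omega>"
    then consider "F (t - S n \<omega>) = 1" | "\<not> K * (F (t - S n \<omega>) - F (s - S n \<omega>)) < (\<Lambda> t \<omega> - \<Lambda> s \<omega>) * (1 - F (t - S n \<omega>))"
      using F_le_1[of "t - S n \<omega>"] by (auto simp: D_def)
    then show "(\<Lambda> t \<omega> - \<Lambda> s \<omega>) * (1 - F (t - S n \<omega>)) \<le> K * (F (t - S n \<omega>) - F (s - S n \<omega>))"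
      using K F_st[of "S n \<omega>"] by cases auto
  qed
qed

text \<open>The factor \<open>exp 1 / (1 - \<rho>)\<close> bounds the expected number of renewals in unit time, and the factor
  two is that of \<open>increment_bound_by_log_survival\<close>.\<close>

abbreviation "tail_constant \<equiv> 2 * (exp 1 / (1 - \<rho>))"

lemma survival_upper_tail:
  assumes "0 < e"
  shows "emeasure M {\<omega> \<in> space M. 1 - F (\<tau> n \<omega>) < e} \<le> ennreal e"
proof -
  have "emeasure M {\<omega> \<in> space M. \<tau> n \<omega> \<in> {x. 1 - F x < e}} = law.prob {x. 1 - F x < e}"
    by (subst emeasure_ident) (auto simp: law.emeasure_eq_measure)
  also have "\<dots> \<le> ennreal e"
    using law.upper_tail_of_cdf[OF continuous_law[unfolded F_def] assms] unfolding F_def by (rule ennreal_leI)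
  finally show ?thesis by simp
qed

lemma AE_survival_positive: "AE \<omega> in M. F (\<tau> n \<omega>) < 1"
proof -
  have "emeasure M {\<omega> \<in> space M. \<not> F (\<tau> n \<omega>) < 1} \<le> 0"
  proof (rule ennreal_le_epsilon)
    fix e :: real assume e: "0 < e"
    have "emeasure M {\<omega> \<in> space M. \<not> F (\<tau> n \<omega>) < 1} \<le> emeasure M {\<omega> \<in> space M. 1 - F (\<tau> n \<omega>) < e}"
      using e by (intro emeasure_mono) auto
    also have "\<dots> \<le> 0 + ennreal e" using survival_upper_tail[OF e] by simp
    finally show "emeasure M {\<omega> \<in> space M. \<not> F (\<tau> n \<omega>) < 1} \<le> 0 + ennreal e" .
  qed
  then show ?thesis by (intro AE_I[of _ _ "{\<omega> \<in> space M. \<not> F (\<tau> n \<omega>) < 1}"]) auto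
qed

lemma log_survival_tail:
  "emeasure M {\<omega> \<in> space M. x < - ln (1 - F (\<tau> n \<omega>))} \<le> ennreal (exp (- x))"
proof -
  have "emeasure M {\<omega> \<in> space M. x < - ln (1 - F (\<tau> n \<omega>))} \<le> emeasure M {\<omega> \<in> space M. 1 - F (\<tau> n \<omega>) < exp (- x)}"
  proof (rule emeasure_mono)
    have "1 - F y < exp (- x)" if "x < - ln (1 - F y)" for y
    proof (cases "F y < 1")
      case True
      then have "1 - F y = exp (ln (1 - F y))" by simp
      also have "\<dots> < exp (- x)" using that by (subst exp_less_cancel_iff) linarith
      finally show ?thesis .
    next
      case False
      then have "1 - F y = 0" using F_le_1[of y] by simp
      then show ?thesis by simp
    qed
    then show "{\<omega> \<in> space M. x < - ln (1 - F (\<tau> n \<omega>))} \<subseteq> {\<omega> \<in> space M. 1 - F (\<tau> n \<omega>) < exp (- x)}" by blast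
  qed measurable
  also have "\<dots> \<le> ennreal (exp (- x))" by (rule survival_upper_tail) simp
  finally show ?thesis .
qed

text \<open>The bound on increments holds outside of one null set for all rational times, hence for all
  times in the interval between two renewals by right continuity of the compensator. A single
  null set for all times is needed since the times of renewals are random.\<close>

lemma compensator_since_last_renewal:
  "AE \<omega> in P. \<forall>n t. S n \<omega> \<le> t \<longrightarrow> t < S (Suc n) \<omega> \<longrightarrow>
    0 \<le> \<Lambda> t \<omega> - \<Lambda> (S n \<omega>) \<omega> \<and> \<Lambda> t \<omega> - \<Lambda> (S n \<omega>) \<omega> \<le> tail_constant * - ln (1 - F (\<tau> n \<omega>))"
proof -
  define K where "K = exp 1 / (1 - \<rho>)"
  have K: "K \<ge> 0" using laplace_less_1 by (simp add: K_def)
  have "AE \<omega> in P. \<forall>n. \<forall>s\<in>\<rat>. \<forall>t\<in>\<rat>. 0 \<le> s \<longrightarrow> s < t \<longrightarrow> t \<le> s + 1 \<longrightarrow> S n \<omega> \<le> s \<longrightarrow> t < S (Suc n) \<omega> \<longrightarrow>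
    (\<Lambda> t \<omega> - \<Lambda> s \<omega>) * (1 - F (t - S n \<omega>)) \<le> K * (F (t - S n \<omega>) - F (s - S n \<omega>))"
    unfolding AE_all_countable AE_ball_countable[OF countable_rat]
  proof (intro allI ballI)
    fix n and s t :: real
    show "AE \<omega> in P. 0 \<le> s \<longrightarrow> s < t \<longrightarrow> t \<le> s + 1 \<longrightarrow> S n \<omega> \<le> s \<longrightarrow> t < S (Suc n) \<omega> \<longrightarrow>
      (\<Lambda> t \<omega> - \<Lambda> s \<omega>) * (1 - F (t - S n \<omega>)) \<le> K * (F (t - S n \<omega>) - F (s - S n \<omega>))"
      using compensator_increment_bound[of s t n] unfolding K_def
      by (cases "0 \<le> s \<and> s < t \<and> t \<le> s + 1") auto
  qed
  moreover have "AE \<omega> in P. \<forall>n. F (\<tau> n \<omega>) < 1"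
    using AE_completion[OF AE_survival_positive] by (simp add: AE_all_countable)
  moreover note AE_compensator_path AE_space[of P]
  ultimately show ?thesis
  proof eventually_elim
    case (elim \<omega>)
    then have \<omega>: "\<omega> \<in> space M" by simp
    have Lmono: "\<Lambda> s \<omega> \<le> \<Lambda> t \<omega>" if "0 \<le> s" "s \<le> t" for s t
      using elim(3) that by (auto dest!: mono_onD[of _ _ s t])
    have Lcont: "((\<lambda>u. \<Lambda> u \<omega>) \<longlongrightarrow> \<Lambda> t \<omega>) (at_right t)" if "0 \<le> t" for t using elim(3) that by blast
    have step: "(\<Lambda> t \<omega> - \<Lambda> s \<omega>) * (1 - F (t - S n \<omega>)) \<le> K * (F (t - S n \<omega>) - F (s - S n \<omega>))"
      if st: "S n \<omega> \<le> s" "s < t" "t < s + 1" "t < S (Suc n) \<omega>" for n s t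
    proof -
      have s0: "0 \<le> s" using st renewal_time_nonneg[OF \<omega>, of n] by linarith
      obtain a where a: "\<And>k :: nat. a k \<in> \<rat>" "\<And>k. s < a k" "\<And>k. a k < t" "filterlim a (at_right s) sequentially"
        using rational_sequence_at_right[OF \<open>s < t\<close>] by blast
      have "t < min (s + 1) (S (Suc n) \<omega>)" using st by simp
      then obtain b where b: "\<And>k :: nat. b k \<in> \<rat>" "\<And>k. t < b k" "\<And>k. b k < min (s + 1) (S (Suc n) \<omega>)"
        "filterlim b (at_right t) sequentially"
        using rational_sequence_at_right by blast
      have La: "(\<lambda>k. \<Lambda> (a k) \<omega>) \<longlonglongrightarrow> \<Lambda> s \<omega>" and Lb: "(\<lambda>k. \<Lambda> (b k) \<omega>) \<longlonglongrightarrow> \<Lambda> t \<omega>"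
        using filterlim_compose[OF Lcont a(4)] filterlim_compose[OF Lcont b(4)] s0 st by auto
      have "a \<longlonglongrightarrow> s" "b \<longlonglongrightarrow> t"
        using a(4) b(4) by (auto simp: filterlim_at)
      then have Fa: "(\<lambda>k. F (a k - S n \<omega>)) \<longlonglongrightarrow> F (s - S n \<omega>)" and Fb: "(\<lambda>k. F (b k - S n \<omega>)) \<longlonglongrightarrow> F (t - S n \<omega>)"
        by (auto intro!: isCont_tendsto_compose[OF continuous_law] tendsto_intros)
      show ?thesis
      proof (rule LIMSEQ_le)
        show "(\<lambda>k. (\<Lambda> (b k) \<omega> - \<Lambda> (a k) \<omega>) * (1 - F (b k - S n \<omega>))) \<longlonglongrightarrow> (\<Lambda> t \<omega> - \<Lambda> s \<omega>) * (1 - F (t - S n \<omega>))"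
          by (intro tendsto_intros La Lb Fb)
        show "(\<lambda>k. K * (F (b k - S n \<omega>) - F (a k - S n \<omega>))) \<longlonglongrightarrow> K * (F (t - S n \<omega>) - F (s - S n \<omega>))"
          by (intro tendsto_intros Fa Fb)
        show "\<exists>N. \<forall>k\<ge>N. (\<Lambda> (b k) \<omega> - \<Lambda> (a k) \<omega>) * (1 - F (b k - S n \<omega>)) \<le> K * (F (b k - S n \<omega>) - F (a k - S n \<omega>))"
        proof (intro exI allI impI)
          fix k
          have "s < a k" "a k < t" "t < b k" "b k < s + 1" "b k < S (Suc n) \<omega>"
            using a(2,3)[of k] b(2,3)[of k] by auto
          then show "(\<Lambda> (b k) \<omega> - \<Lambda> (a k) \<omega>) * (1 - F (b k - S n \<omega>)) \<le> K * (F (b k - S n \<omega>) - F (a k - S n \<omega>))"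
            using elim(1) a(1)[of k] b(1)[of k] s0 st by auto
        qed
      qed
    qed
    show ?case
    proof (intro allI impI)
      fix n t assume t: "S n \<omega> \<le> t" "t < S (Suc n) \<omega>"
      have S0: "0 \<le> S n \<omega>" by (rule renewal_time_nonneg[OF \<omega>])
      have le: "t - S n \<omega> \<le> \<tau> n \<omega>" using t by (simp add: renewal_time_Suc)
      have F1: "F (t - S n \<omega>) \<le> F (\<tau> n \<omega>)" "F (\<tau> n \<omega>) < 1" using monoD[OF mono_F le] elim(2) by auto
      have "\<Lambda> (S n \<omega> + (t - S n \<omega>)) \<omega> - \<Lambda> (S n \<omega> + 0) \<omega> \<le> 2 * K * (ln (1 - F 0) - ln (1 - F (t - S n \<omega>)))"
      proof (rule increment_bound_by_log_survival[OF mono_F continuous_law _ _ K, where g = "\<lambda>u. \<Lambda> (S n \<omega> + u) \<omega>"])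
        fix u v assume "0 \<le> u" "u < v" "v \<le> t - S n \<omega>" "v < u + 1"
        then show "(\<Lambda> (S n \<omega> + v) \<omega> - \<Lambda> (S n \<omega> + u) \<omega>) * (1 - F v) \<le> K * (F v - F u)"
          using step[of n "S n \<omega> + u" "S n \<omega> + v"] t by simp
      qed (use t F1 in auto)
      also have "\<dots> \<le> 2 * K * - ln (1 - F (\<tau> n \<omega>))"
      proof (rule mult_left_mono)
        have "F 0 \<le> F (t - S n \<omega>)" using t by (intro monoD[OF mono_F]) simp
        then have "ln (1 - F 0) \<le> 0" using F_nonneg[of 0] F1 by simp
        moreover have "ln (1 - F (\<tau> n \<omega>)) \<le> ln (1 - F (t - S n \<omega>))" using F1 by simp
        ultimately show "ln (1 - F 0) - ln (1 - F (t - S n \<omega>)) \<le> - ln (1 - F (\<tau> n \<omega>))" by linarith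
      qed (use K in simp)
      finally show "0 \<le> \<Lambda> t \<omega> - \<Lambda> (S n \<omega>) \<omega> \<and> \<Lambda> t \<omega> - \<Lambda> (S n \<omega>) \<omega> \<le> tail_constant * - ln (1 - F (\<tau> n \<omega>))"
        using Lmono[OF S0 t(1)] by (simp add: K_def)
    qed
  qed
qed

section \<open>Growth of the compensator since the last renewal\<close>

text \<open>The unscaled process of the theorem. It vanishes at each renewal and grows with the compensator
  in between.\<close>

definition residual :: "real \<Rightarrow> 'a \<Rightarrow> real" where
  "residual t \<omega> = \<Lambda> t \<omega> - \<Lambda> (S (N t \<omega> - 1) \<omega>) \<omega>"

lemma residual_eq:
  assumes "\<omega> \<in> space M" "S n \<omega> \<le> t" "t < S (Suc n) \<omega>"
  shows "residual t \<omega> = \<Lambda> t \<omega> - \<Lambda> (S n \<omega>) \<omega>"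
  using renewal_count_eq[OF assms] by (simp add: residual_def)

lemma residual_cadlag:
  assumes ne: "no_explosion \<omega>"
    and path: "mono_on {0..} (\<lambda>t. \<Lambda> t \<omega>)" "\<And>t. 0 \<le> t \<Longrightarrow> ((\<lambda>u. \<Lambda> u \<omega>) \<longlongrightarrow> \<Lambda> t \<omega>) (at_right t)"
  shows "0 \<le> t \<Longrightarrow> ((\<lambda>u. residual u \<omega>) \<longlongrightarrow> residual t \<omega>) (at_right t)"
    and "0 < t \<Longrightarrow> \<exists>l. ((\<lambda>u. residual u \<omega>) \<longlongrightarrow> l) (at_left t)"
proof -
  have \<omega>: "\<omega> \<in> space M" using ne by (simp add: no_explosion_def)
  {
    assume t: "0 \<le> t"
    obtain n where n: "S n \<omega> \<le> t" "t < S (Suc n) \<omega>" using current_renewal[OF ne t] by blast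
    have ev: "\<forall>\<^sub>F u in at_right t. \<Lambda> u \<omega> - \<Lambda> (S n \<omega>) \<omega> = residual u \<omega>"
      unfolding eventually_at_right_field
      by (rule exI[of _ "S (Suc n) \<omega>"]) (use n residual_eq[OF \<omega>, of n] in auto)
    show "((\<lambda>u. residual u \<omega>) \<longlongrightarrow> residual t \<omega>) (at_right t)"
      unfolding residual_eq[OF \<omega> n]
      by (rule Lim_transform_eventually[OF _ ev]) (intro tendsto_intros path t)
  next
    assume t: "0 < t"
    obtain n where n: "S n \<omega> < t" "t \<le> S (Suc n) \<omega>"
    proof -
      obtain k where k: "S k \<omega> \<le> t" "t < S (Suc k) \<omega>" using current_renewal[OF ne, of t] t by auto
      show thesis
      proof (cases "S k \<omega> = t")
        case True
        then obtain m where "k = Suc m" using t by (cases k) auto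
        then show thesis using True renewal_time_less_Suc[OF \<omega>, of m] by (intro that[of m]) auto
      qed (use k in \<open>auto intro!: that[of k]\<close>)
    qed
    have S0: "0 \<le> S n \<omega>" by (rule renewal_time_nonneg[OF \<omega>])
    have ev: "\<forall>\<^sub>F u in at_left t. \<Lambda> u \<omega> - \<Lambda> (S n \<omega>) \<omega> = residual u \<omega>"
      unfolding eventually_at_left_field
      by (rule exI[of _ "S n \<omega>"]) (use n residual_eq[OF \<omega>, of n] in auto)
    have "\<exists>l. ((\<lambda>u. \<Lambda> u \<omega>) \<longlongrightarrow> l) (at_left t)"
    proof -
      \<comment> \<open>Monotone on the whole line, and equal to the compensator on positive times.\<close>
      define m where "m u = \<Lambda> (max 0 u) \<omega>" for u
      have m: "m u \<le> m v" if "u \<le> v" for u v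
        unfolding m_def using that by (intro mono_onD[OF path(1)]) auto
      have "(m \<longlongrightarrow> Sup (m ` ({..<t} \<inter> UNIV))) (at t within ({..<t} \<inter> UNIV))"
        by (rule Lim_left_bound[where K = "m t"]) (auto intro: m)
      moreover have "\<forall>\<^sub>F u in at_left t. m u = \<Lambda> u \<omega>"
        unfolding eventually_at_left_field by (rule exI[of _ 0]) (use t in \<open>auto simp: m_def max_def\<close>)
      ultimately show ?thesis by (auto intro: Lim_transform_eventually)
    qed
    then obtain l where "((\<lambda>u. \<Lambda> u \<omega>) \<longlongrightarrow> l) (at_left t)" by blast
    then have "((\<lambda>u. \<Lambda> u \<omega> - \<Lambda> (S n \<omega>) \<omega>) \<longlongrightarrow> l - \<Lambda> (S n \<omega>) \<omega>) (at_left t)" by (intro tendsto_intros)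
    then show "\<exists>l. ((\<lambda>u. residual u \<omega>) \<longlongrightarrow> l) (at_left t)"
      using ev by (blast intro: Lim_transform_eventually)
  }
qed

text \<open>The compensator is evaluated at a random time, which is where predictability enters: it makes
  the compensator jointly measurable in time and in \<open>\<omega>\<close>.\<close>

lemma measurable_residual:
  assumes t: "0 \<le> t"
  shows "residual t \<in> borel_measurable P"
proof -
  have pair: "(\<lambda>\<omega>. (S n \<omega>, \<omega>)) \<in> measurable P (predictable_sigma (space P) \<F>)" for n
    unfolding predictable_sigma_def
  proof (rule measurable_measure_of)
    show "{{0} \<times> A |A. A \<in> sets (\<F> 0)} \<union> {{s<..t} \<times> A |s t A. 0 \<le> s \<and> s < t \<and> A \<in> sets (\<F> s)}
        \<subseteq> Pow ({0..} \<times> space P)"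
      using sets.sets_into_space[of _ "\<F> _"] by fastforce
    show "(\<lambda>\<omega>. (S n \<omega>, \<omega>)) \<in> space P \<rightarrow> {0..} \<times> space P" using renewal_time_nonneg by auto
    have [measurable]: "S n \<in> borel_measurable P" by (rule measurable_completion) measurable
    fix Y assume "Y \<in> {{0} \<times> A |A. A \<in> sets (\<F> 0)} \<union> {{s<..t} \<times> A |s t A. 0 \<le> s \<and> s < t \<and> A \<in> sets (\<F> s)}"
    then have "\<exists>B s A. Y = B \<times> A \<and> B \<in> sets borel \<and> 0 \<le> s \<and> A \<in> sets (\<F> s)"
    proof
      assume "Y \<in> {{0} \<times> A |A. A \<in> sets (\<F> 0)}"
      then obtain A where "Y = {0} \<times> A" "A \<in> sets (\<F> 0)" by blast
      then show ?thesis by (intro exI[of _ "{0}"] exI[of _ 0] exI[of _ A]) auto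
    next
      assume "Y \<in> {{s<..t} \<times> A |s t A. 0 \<le> s \<and> s < t \<and> A \<in> sets (\<F> s)}"
      then obtain s t A where "Y = {s<..t} \<times> A" "0 \<le> s" "A \<in> sets (\<F> s)" by blast
      then show ?thesis by (intro exI[of _ "{s<..t}"] exI[of _ s] exI[of _ A]) auto
    qed
    then obtain B s A where Y: "Y = B \<times> A" "B \<in> sets borel" "0 \<le> s" "A \<in> sets (\<F> s)" by blast
    have A: "A \<in> sets P" using Y subalgebra_filtration[of s] by (auto simp: subalgebra_def)
    have "(\<lambda>\<omega>. (S n \<omega>, \<omega>)) -` Y \<inter> space P = (S n -` B \<inter> space P) \<inter> A"
      using sets.sets_into_space[OF A] by (auto simp: Y)
    also have "\<dots> \<in> sets P" using A Y by (intro sets.Int measurable_sets[of "S n" P borel]) auto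
    finally show "(\<lambda>\<omega>. (S n \<omega>, \<omega>)) -` Y \<inter> space P \<in> sets P" .
  qed
  have "(\<lambda>(t, \<omega>). \<Lambda> t \<omega>) \<in> borel_measurable (predictable_sigma (space P) \<F>)"
    using compensator by (simp add: is_compensator_def predictable_def)
  from measurable_compose[OF pair this]
  have at_renewal: "(\<lambda>\<omega>. \<Lambda> (S n \<omega>) \<omega>) \<in> borel_measurable P" for n by simp
  have "(\<lambda>\<omega>. nat \<lfloor>real (N t \<omega>)\<rfloor> - 1) \<in> measurable P (count_space UNIV)"
    using measurable_renewal_count[OF t] by measurable
  then have "(\<lambda>\<omega>. \<Lambda> (S (N t \<omega> - 1) \<omega>) \<omega>) \<in> borel_measurable P"
    using measurable_compose_countable[OF at_renewal] by simp
  then show ?thesis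
    unfolding residual_def[abs_def] using integrable_compensator[OF t] by (intro borel_measurable_diff) auto
qed

lemma scaled_residual_cadlag:
  assumes T: "0 < T"
  shows "AE \<omega> in P. cadlag01 (\<lambda>v. c * residual (T * v) \<omega>)"
  using AE_completion[OF AE_no_explosion] AE_compensator_path
proof eventually_elim
  case (elim \<omega>)
  note cad = residual_cadlag[of \<omega>]
  show ?case unfolding cadlag01_def
  proof (intro conjI ballI)
    fix t :: real assume t: "t \<in> {0..<1}"
    have "filterlim (\<lambda>v. T * v) (at_right (T * t)) (at_right t)"
      using T by (intro tendsto_imp_filterlim_at_right tendsto_intros) (auto simp: eventually_at_right_field intro: exI[of _ "t + 1"])
    then have "((\<lambda>v. residual (T * v) \<omega>) \<longlongrightarrow> residual (T * t) \<omega>) (at_right t)"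
      using elim t T by (intro filterlim_compose[OF cad(1)]) auto
    then show "((\<lambda>v. c * residual (T * v) \<omega>) \<longlongrightarrow> c * residual (T * t) \<omega>) (at_right t)"
      by (intro tendsto_intros)
  next
    fix t :: real assume t: "t \<in> {0<..1}"
    have lim: "filterlim (\<lambda>v. T * v) (at_left (T * t)) (at_left t)"
      using T by (intro tendsto_imp_filterlim_at_left tendsto_intros) (auto simp: eventually_at_left_field intro: exI[of _ "t - 1"])
    obtain l where "((\<lambda>u. residual u \<omega>) \<longlongrightarrow> l) (at_left (T * t))"
      using cad(2)[of "T * t"] elim t T by auto
    from tendsto_mult_left[OF filterlim_compose[OF this lim], of c]
    show "\<exists>l. ((\<lambda>v. c * residual (T * v) \<omega>) \<longlongrightarrow> l) (at_left t)" by blast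
  qed
qed

text \<open>Paths that are not cadlag are mapped to the zero element, so the random element is that of a
  process all of whose paths are cadlag, obtained by changing the paths on a null set.\<close>

lemma measurable_scaled_residual:
  assumes T: "0 < T"
  shows "(\<lambda>\<omega>. to_D01 (\<lambda>v. c * residual (T * v) \<omega>)) \<in> borel_measurable P"
proof -
  define G where "G = {\<omega> \<in> space P. cadlag01 (\<lambda>v. c * residual (T * v) \<omega>)}"
  have "{\<omega> \<in> space P. \<not> cadlag01 (\<lambda>v. c * residual (T * v) \<omega>)} \<in> null_sets P"
    unfolding completion.AE_iff_null_sets[symmetric] by (rule scaled_residual_cadlag[OF T])
  then have "space P - {\<omega> \<in> space P. \<not> cadlag01 (\<lambda>v. c * residual (T * v) \<omega>)} \<in> sets P" by auto
  also have "space P - {\<omega> \<in> space P. \<not> cadlag01 (\<lambda>v. c * residual (T * v) \<omega>)} = G" by (auto simp: G_def)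
  finally have G[measurable]: "G \<in> sets P" .
  have "(\<lambda>\<omega>. to_D01 (\<lambda>v. if \<omega> \<in> G then c * residual (T * v) \<omega> else 0)) \<in> borel_measurable P"
  proof (rule measurable_to_D01)
    fix v :: real assume "v \<in> {0..1}"
    then have [measurable]: "residual (T * v) \<in> borel_measurable P" using T by (intro measurable_residual) auto
    show "(\<lambda>\<omega>. if \<omega> \<in> G then c * residual (T * v) \<omega> else 0) \<in> borel_measurable P" by measurable
  next
    fix \<omega> assume "\<omega> \<in> space P"
    then show "cadlag01 (\<lambda>v. if \<omega> \<in> G then c * residual (T * v) \<omega> else 0)"
      by (cases "\<omega> \<in> G") (auto simp: G_def cadlag01_const)
  qed
  also have "?this \<longleftrightarrow> ?thesis"
    by (intro measurable_cong) (auto simp: to_D01_def G_def cadlag01_const)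
  finally show ?thesis .
qed

text \<open>By \<open>renewal_time_tail\<close>, up to time \<open>T\<close> at most \<open>k * nat \<lceil>T\<rceil>\<close> renewals occur, except with a probability that is
  exponentially small in \<open>T\<close>.\<close>

lemma exists_renewal_horizon: "\<exists>k. \<forall>T>0. ennreal (exp T * \<rho> ^ (k * nat \<lceil>T\<rceil>)) \<le> ennreal (exp (- T))"
proof -
  \<comment> \<open>The exponent 2 beats the factor \<open>exp T\<close> of the tail bound and leaves \<open>exp (- T)\<close>.\<close>
  obtain k where k: "\<rho> ^ k < exp (- 2)"
    using real_arch_pow_inv[of "exp (- 2)" \<rho>] laplace_less_1 by auto
  have "exp T * \<rho> ^ (k * nat \<lceil>T\<rceil>) \<le> exp (- T)" if T: "T > 0" for T
  proof -
    have "\<rho> ^ (k * nat \<lceil>T\<rceil>) = (\<rho> ^ k) ^ nat \<lceil>T\<rceil>" by (rule power_mult)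
    also have "\<dots> \<le> exp (- 2) ^ nat \<lceil>T\<rceil>" using k laplace_nonneg by (intro power_mono) auto
    also have "\<dots> = exp (- 2 * real (nat \<lceil>T\<rceil>))" by (simp add: exp_of_nat_mult[symmetric] mult.commute)
    also have "\<dots> \<le> exp (- 2 * T)" using T by simp
    finally have "exp T * \<rho> ^ (k * nat \<lceil>T\<rceil>) \<le> exp T * exp (- 2 * T)" by (intro mult_left_mono) auto
    then show ?thesis by (simp add: exp_add[symmetric])
  qed
  then show ?thesis by (auto intro!: ennreal_leI)
qed

text \<open>Outside of the event \<open>A T\<close> at most \<open>m T\<close> renewals occur up to time \<open>T\<close>, a number linear in \<open>T\<close>, and none of
  the corresponding variables \<open>- ln (1 - F (\<tau> n))\<close> exceeds the level \<open>a * T powr p\<close>. The probability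
  of \<open>A T\<close> tends to zero because the exponential tail at this level beats the linear number of
  variables.\<close>

theorem scaled_residual_converges:
  assumes p: "0 < p"
  shows "converges_in_law P (\<lambda>T \<omega>. to_D01 (\<lambda>v. 1 / T powr p * residual (T * v) \<omega>))
           (return borel (to_D01 (\<lambda>_. 0))) at_top"
proof (rule converges_in_law_const)
  show "prob_space P" by (rule prob_space_completion)
  show "\<forall>\<^sub>F T in at_top. (\<lambda>\<omega>. to_D01 (\<lambda>v. 1 / T powr p * residual (T * v) \<omega>)) \<in> borel_measurable P"
    using eventually_gt_at_top[of 0] by eventually_elim (rule measurable_scaled_residual)
next
  fix e :: real assume e: "e > 0"
  obtain k where k: "\<And>T. T > 0 \<Longrightarrow> ennreal (exp T * \<rho> ^ (k * nat \<lceil>T\<rceil>)) \<le> ennreal (exp (- T))"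
    using exists_renewal_horizon by blast
  have K: "tail_constant > 0" using laplace_less_1 by simp
  define m where "m T = k * nat \<lceil>T\<rceil>" for T :: real
  \<comment> \<open>The level at which the bound on the residual by the logarithm becomes \<open>e * T powr p\<close>.\<close>
  define a where "a = e / tail_constant"
  have a: "a > 0" unfolding a_def using e K by (rule divide_pos_pos)
  have Ka: "tail_constant * a = e"
    unfolding a_def times_divide_eq_right using K by (intro nonzero_mult_div_cancel_left) linarith
  define B where "B T n = {\<omega> \<in> space M. a * T powr p < - ln (1 - F (\<tau> n \<omega>))}" for T n
  define A where "A T = {\<omega> \<in> space M. S (m T) \<omega> \<le> T} \<union> (\<Union>n<m T. B T n)" for T
  have B[measurable]: "B T n \<in> sets M" for T n unfolding B_def by measurable
  have A[measurable]: "A T \<in> sets M" for T unfolding A_def by measurable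
  have close: "AE \<omega> in P. \<omega> \<notin> A T \<longrightarrow>
      dist (to_D01 (\<lambda>v. 1 / T powr p * residual (T * v) \<omega>)) (to_D01 (\<lambda>_. 0)) \<le> e" if T: "T > 0" for T
    using scaled_residual_cadlag[OF T, of "1 / T powr p"] compensator_since_last_renewal AE_completion[OF AE_no_explosion]
  proof eventually_elim
    case (elim \<omega>)
    have \<omega>: "\<omega> \<in> space M" using elim(3) by (simp add: no_explosion_def)
    show ?case
    proof
      assume out: "\<omega> \<notin> A T"
      have "\<bar>1 / T powr p * residual (T * v) \<omega>\<bar> \<le> e" if v: "v \<in> {0..1}" for v
      proof -
        have Tv: "0 \<le> T * v" "T * v \<le> T" using v T by (auto simp: mult_left_le)
        obtain n where n: "S n \<omega> \<le> T * v" "T * v < S (Suc n) \<omega>" using current_renewal[OF elim(3) Tv(1)] by blast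
        have "T < S (m T) \<omega>" using out \<omega> by (auto simp: A_def)
        then have "n < m T" using renewals_upto[OF \<omega> n, of "m T"] Tv by auto
        then have "- ln (1 - F (\<tau> n \<omega>)) \<le> a * T powr p" using out \<omega> by (auto simp: A_def B_def not_less)
        then have "tail_constant * - ln (1 - F (\<tau> n \<omega>)) \<le> tail_constant * (a * T powr p)"
          using K by (intro mult_left_mono) auto
        also have "\<dots> = e * T powr p" by (simp only: mult.assoc[symmetric] Ka)
        finally have "0 \<le> residual (T * v) \<omega>" "residual (T * v) \<omega> \<le> e * T powr p"
          using elim(2) n residual_eq[OF \<omega> n] by (smt (verit))+
        then show ?thesis using T by (simp add: abs_mult divide_le_eq)
      qed
      then show "dist (to_D01 (\<lambda>v. 1 / T powr p * residual (T * v) \<omega>)) (to_D01 (\<lambda>_. 0)) \<le> e"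
        using e by (intro dist_to_D01_le[OF elim(1) cadlag01_const time_change_id]) auto
    qed
  qed
  have prob_A: "measure P (A T) \<le> exp (- T) + real k * (T + 1) * exp (- (a * T powr p))" if T: "T > 0" for T
  proof -
    have "emeasure M (A T) \<le> emeasure M {\<omega> \<in> space M. S (m T) \<omega> \<le> T} + emeasure M (\<Union>n<m T. B T n)"
      unfolding A_def by (rule emeasure_subadditive) measurable
    also have "\<dots> \<le> ennreal (exp (- T)) + (\<Sum>n<m T. emeasure M (B T n))"
      using order_trans[OF renewal_time_tail k[OF T]]
      by (intro add_mono emeasure_subadditive_finite) (auto simp: m_def)
    also have "(\<Sum>n<m T. emeasure M (B T n)) \<le> (\<Sum>n<m T. ennreal (exp (- (a * T powr p))))"
      unfolding B_def by (intro sum_mono log_survival_tail)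
    also have "\<dots> = ennreal (real (m T) * exp (- (a * T powr p)))"
      by (simp add: ennreal_mult ennreal_of_nat_eq_real_of_nat)
    also have "\<dots> \<le> ennreal (real k * (T + 1) * exp (- (a * T powr p)))"
    proof (intro ennreal_leI mult_right_mono)
      have "real (nat \<lceil>T\<rceil>) \<le> T + 1" using T by linarith
      then show "real (m T) \<le> real k * (T + 1)" unfolding m_def of_nat_mult by (intro mult_left_mono) auto
    qed simp
    finally have "emeasure M (A T) \<le> ennreal (exp (- T)) + ennreal (real k * (T + 1) * exp (- (a * T powr p)))"
      by (simp add: add_left_mono)
    also have "\<dots> = ennreal (exp (- T) + real k * (T + 1) * exp (- (a * T powr p)))"
      using T by (intro ennreal_plus[symmetric]) auto
    finally have "ennreal (prob (A T)) \<le> ennreal (exp (- T) + real k * (T + 1) * exp (- (a * T powr p)))"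
      unfolding emeasure_eq_measure .
    then show ?thesis using T by (subst (asm) ennreal_le_iff) (simp_all add: measure_completion[OF A])
  qed
  have lim: "((\<lambda>T. exp (- T) + real k * (T + 1) * exp (- (a * T powr p))) \<longlongrightarrow> 0) at_top"
  proof -
    have "((\<lambda>T. (T + 1) * exp (- (a * T powr p))) \<longlongrightarrow> 0) at_top" using a p by real_asymp
    moreover have "((\<lambda>T :: real. exp (- T)) \<longlongrightarrow> 0) at_top" by real_asymp
    ultimately show ?thesis
      using tendsto_add[OF _ tendsto_mult_left[where c = "real k"]] by (fastforce simp: mult.assoc)
  qed
  have "((\<lambda>T. measure P (A T)) \<longlongrightarrow> 0) at_top"
  proof (rule tendsto_sandwich[OF _ _ tendsto_const lim])
    show "\<forall>\<^sub>F T in at_top. measure P (A T) \<le> exp (- T) + real k * (T + 1) * exp (- (a * T powr p))"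
      using eventually_gt_at_top[of 0] by eventually_elim (rule prob_A)
  qed simp
  moreover have "\<forall>\<^sub>F T in at_top. A T \<in> sets P \<and> (AE \<omega> in P. \<omega> \<notin> A T \<longrightarrow>
      dist (to_D01 (\<lambda>v. 1 / T powr p * residual (T * v) \<omega>)) (to_D01 (\<lambda>_. 0)) \<le> e)"
    using eventually_gt_at_top[of 0]
  proof eventually_elim
    case (elim T)
    have "A T \<in> sets P" using A[of T] by (rule sets_completionI_sets)
    then show ?case using close[OF elim] by (rule conjI)
  qed
  ultimately show "\<exists>A. (\<forall>\<^sub>F T in at_top. A T \<in> sets P \<and> (AE \<omega> in P. \<omega> \<notin> A T \<longrightarrow>
      dist (to_D01 (\<lambda>v. 1 / T powr p * residual (T * v) \<omega>)) (to_D01 (\<lambda>_. 0)) \<le> e)) \<and>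
      ((\<lambda>T. measure P (A T)) \<longlongrightarrow> 0) at_top"
    by (intro exI[of _ A] conjI)
qed

end

theorem theorem1p6:
  fixes M :: "'a measure" and \<tau> :: "nat \<Rightarrow> 'a \<Rightarrow> real" and f :: "real \<Rightarrow> real"
    and \<Lambda> :: "real \<Rightarrow> 'a \<Rightarrow> real" and p :: real
  defines "S \<equiv> renewal_time \<tau>" and "N \<equiv> renewal_count \<tau>"
    and "P \<equiv> completion M"
  defines "Z \<equiv> \<lambda>T v \<omega>. 1 / T powr p * (\<Lambda> (T * v) \<omega> - \<Lambda> (S (N (T * v) \<omega> - 1) \<omega>) \<omega>)"
  assumes "prob_space M"
    and "prob_space.indep_vars M (\<lambda>_. borel) \<tau> UNIV"
    and "\<And>i. distr M borel (\<tau> i) = distr M borel (\<tau> 0)"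
    and "\<And>i \<omega>. \<omega> \<in> space M \<Longrightarrow> 0 < \<tau> i \<omega>"
    and "\<And>x. 0 \<le> f x"
    and "distributed M lborel (\<tau> 0) (\<lambda>x. ennreal (f x))"
    and "integrable (distr M borel (\<tau> 0)) (\<lambda>x. x)"
    and "is_compensator P (augmented_filtration M (\<lambda>t \<omega>. real (N t \<omega>)))
           (\<lambda>t \<omega>. real (N t \<omega>)) \<Lambda>"
    and "0 < p"
  shows "(\<forall>T>0. AE \<omega> in P. cadlag01 (\<lambda>v. Z T v \<omega>)) \<and>
         converges_in_law P (\<lambda>T \<omega>. to_D01 (\<lambda>v. Z T v \<omega>))
           (return borel (to_D01 (\<lambda>_. 0))) at_top"
proof -
  interpret positive_renewal M \<tau>
    using assms(5-8) by (intro positive_renewal.intro positive_renewal_axioms.intro)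
  interpret law: real_distribution "distr M borel (\<tau> 0)" by (rule real_distribution_distr) simp
  have atomless: "isCont F x" for x
  proof -
    have [measurable]: "(\<lambda>x. ennreal (f x)) \<in> borel_measurable lborel"
      using assms(10) by (rule distributed_borel_measurable)
    have "emeasure (distr M borel (\<tau> 0)) {x} = emeasure (distr M lborel (\<tau> 0)) {x}"
      by (intro arg_cong2[where f = emeasure] distr_cong) auto
    also have "\<dots> = (\<integral>\<^sup>+y. ennreal (f y) * indicator {x} y \<partial>lborel)"
      using assms(10) by (subst distributed_distr_eq_density[OF assms(10)], subst emeasure_density)
        (auto dest: distributed_borel_measurable)
    also have "\<dots> = 0"
    proof (subst nn_integral_0_iff_AE)
      show "AE y in lborel. ennreal (f y) * indicator {x} y = 0"
        using AE_lborel_singleton[of x] by eventually_elim auto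
    qed measurable
    finally show ?thesis unfolding F_def by (simp add: law.isCont_cdf measure_def)
  qed
  interpret renewal_compensator M \<tau> \<Lambda>
    using assms(12) atomless by unfold_locales (simp_all add: P_def N_def)
  have Z: "Z T v \<omega> = 1 / T powr p * residual (T * v) \<omega>" for T v \<omega>
    by (simp add: Z_def S_def N_def residual_def)
  show ?thesis
    unfolding Z P_def using scaled_residual_cadlag scaled_residual_converges[OF \<open>0 < p\<close>] by blast
qed

end
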